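(* Let $M\subset\mathbb{R}^2$ be a Lebesgue measurable set with finite Lebesgue measure, and let $M^*$ be the ball centered at the origin with $\lambda(M^* )=\lambda(M)$. Let $\{f_n\}_{n\ge 1}$ be the Kakutani-Fibonacci sequence of points, let $u_n=e^{i\pi f_n}$ be the corresponding directions, and let $T_nM=S_{u_n}S_{u_{n-1}}\cdots S_{u_1}M$ be the set obtained from $M$ by successive Steiner symmetrizations in the directions $u_1,u_2,\dots,u_n$ (in this order). Then $$\lim_{n\to\infty}T_nM=M^*$$ with respect to the distance $d_1$, i.e. $\lim_{n\to\infty}\lambda\big(T_nM\,\triangle\, M^*\big)=0$.
   Context: $\lambda$ denotes Lebesgue measure (in any dimension) and $\lambda^*$ Lebesgue outer measure. Measurable sets of finite measure are identified when their symmetric difference has measure zero, and $d_1(M_1,M_2)=\lambda(M_1\triangle M_2)$. The plane $\mathbb{R}^2$ is identified with $\mathbb{C}$ when writing unit vectors as $e^{i\vartheta}$. Steiner symmetral: for a unit vector $u\in S^1$, let $l_u$ be the line through the origin parallel to $u$ and $l_{u^\perp}$ the line through the origin orthogonal to $u$. For a measurable $M\subset\mathbb{R}^2$ of finite measure, the Steiner symmetral $S_uM$ is the union, over those $x\in l_{u^\perp}$ for which the line $x+l_u$ meets $M$, of the closed segment contained in $x+l_u$, centered at $x$, with length equal to the one-dimensional outer measure $\lambda^*(M\cap(x+l_u))$ (the segment is the single point $\{x\}$ if this length is $0$ and the whole line if it is infinite). Kakutani-Fibonacci sequence: let $\gamma=\frac12(\sqrt5-1)$, so $1-\gamma=\gamma^2$.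 For a positive integer $n$ write its binary representation as $n=\sum_{k=0}^{N}a_k(n)2^k$ with $N=\lfloor\log_2 n\rfloor$, $a_k(n)\in\{0,1\}$, and $a_k(n)=0$ for $k>N$. Let $\mathbb{N}_\gamma$ be the set of positive integers $n$ such that $a_{k+1}(n)a_k(n)=0$ for every $k\ge 0$. Define the $\gamma$-radical inverse function on $\mathbb{N}_\gamma$ by $\Phi_\gamma(n)=\sum_{k=0}^{N}a_k(n)\gamma^{k+1}$. If $n_1<n_2<n_3<\cdots$ is the increasing enumeration of $\mathbb{N}_\gamma$, then $f_j=\Phi_\gamma(n_j)$ for $j\ge 1$. Thus the sequence starts with $\gamma,\ \gamma^2,\ \gamma^3,\ \gamma^3+\gamma,\ \gamma^4,\ \gamma^4+\gamma,\ \gamma^4+\gamma^2,\ \gamma^5,\dots$ *)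

theory Defs
  imports "HOL-Analysis.Analysis" "HOL-Library.Infinite_Set"
begin

text \<open>
  The plane is the type \<^typ>\<open>complex\<close>, with its Euclidean structure. For a unit vector
  \<open>u\<close>, the map \<open>t \<mapsto> x + t u\<close> is an isometry of the real line onto the line through
  \<open>x\<close> parallel to \<open>u\<close>, so the one-dimensional outer measure of the section of \<open>M\<close>
  by that line is the outer measure of the corresponding set of parameters.
\<close>

definition section_length :: "complex \<Rightarrow> complex set \<Rightarrow> complex \<Rightarrow> ennreal" where
  "section_length u M x = outer_measure_of lebesgue {t::real. x + of_real t * u \<in> M}"

text \<open>
  The length lives in \<^typ>\<open>ennreal\<close>: the segment below is \<open>{x}\<close> for a section of
  length \<open>0\<close> and the whole line for a section of infinite length. Only meaningful for
  \<open>norm u = 1\<close>.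
\<close>

definition steiner :: "complex \<Rightarrow> complex set \<Rightarrow> complex set" where
  "steiner u M =
     (\<Union>x \<in> {x. x \<bullet> u = 0 \<and> (\<exists>t::real. x + of_real t * u \<in> M)}.
        {x + of_real t * u | t::real. ennreal (2 * \<bar>t\<bar>) \<le> section_length u M x})"

definition kf_gamma :: real where
  "kf_gamma = (sqrt 5 - 1) / 2"

definition N_gamma :: "nat set" where
  "N_gamma = {n. n > 0 \<and> (\<forall>k. \<not> (bit n (k + 1) \<and> bit n k))}"

definition radical_inverse :: "nat \<Rightarrow> real" where
  "radical_inverse n = (\<Sum>k = 0..nat \<lfloor>log 2 (real n)\<rfloor>. of_bool (bit n k) * kf_gamma ^ (k + 1))"

text \<open>
  \<^const>\<open>enumerate\<close> counts from \<open>0\<close>, and it is the increasing enumeration because the set is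
  infinite. The sequence is indexed by \<open>j \<ge> 1\<close>; its value at \<open>0\<close> is a dummy.
\<close>

lemma infinite_N_gamma: "infinite N_gamma"
proof -
  have "range (\<lambda>k. 2 ^ k :: nat) \<subseteq> N_gamma"
    by (auto simp: N_gamma_def bit_exp_iff)
  moreover have "infinite (range (\<lambda>k. 2 ^ k :: nat))"
    by (rule range_inj_infinite) (auto intro: injI)
  ultimately show ?thesis
    using finite_subset by blast
qed

definition kakutani_fibonacci :: "nat \<Rightarrow> real" where
  "kakutani_fibonacci j = radical_inverse (enumerate N_gamma (j - 1))"

fun steiner_iter :: "(nat \<Rightarrow> complex) \<Rightarrow> nat \<Rightarrow> complex set \<Rightarrow> complex set" where
  "steiner_iter u 0 M = M"
| "steiner_iter u (Suc n) M = steiner (u (Suc n)) (steiner_iter u n M)"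

definition d1 :: "complex set \<Rightarrow> complex set \<Rightarrow> real" where
  "d1 A B = measure lebesgue (sym_diff A B)"

end

theory Submission
  imports Defs "HOL-Computational_Algebra.Primes"
begin

text \<open>
  Write \<open>S\<^sub>v\<close> for the symmetrization in the direction \<open>v\<close> and \<open>K\<^sub>n\<close> for the set after \<open>n\<close> steps.
  Symmetrization is monotone and preserves measure, hence it does not increase the distance
  \<^const>\<open>d1\<close>, and it fixes balls up to null sets. So the distance from \<open>K\<^sub>n\<close> to the ball decreases
  with \<open>n\<close>, and it suffices to make it small at a single step; moreover \<open>M\<close> may be
  replaced by a compact subset of almost the same measure.

  How small it is at a given step is governed by a stability estimate (\<open>ball_deficit_le\<close>): a set \<open>L\<close>
  that is almost fixed by \<open>S\<^sub>v\<close> for \<^emph>\<open>every\<close> direction \<open>v\<close> is almost a centred ball. Indeed, if \<open>x\<close> lies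
  in \<open>L\<close> outside the ball and \<open>y\<close> in the ball outside \<open>L\<close>, then \<open>y\<close> is nearer to the origin than \<open>x\<close>, so
  the symmetral of \<open>L\<close> in the direction of \<open>y - x\<close> cannot contain \<open>x\<close> without containing \<open>y\<close>; Fubini's
  theorem over all differences \<open>y - x\<close> bounds the measure of such pairs.

  It remains to see that some late \<open>K\<^sub>n\<close> is almost fixed in all directions. The integral of
  \<open>\<bar>z\<bar>\<^sup>2\<close> decreases in each step by an amount that controls the distance of the set from its
  symmetral (\<open>energy_steiner\<close>), so consecutive sets \<open>K\<^sub>n\<close> become close. The sequence
  satisfies \<open>f\<^sub>j\<^sub>+\<^sub>1 = f\<^sub>j + \<gamma>\<close> infinitely often (\<open>kakutani_fibonacci_step\<close>), since adding one to an
  index that ends in two zero digits adds just the digit of weight \<open>\<gamma>\<close>. A symmetral is invariant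
  under a reflection, so at such steps \<open>K\<^sub>n\<close> is almost invariant under two reflections and hence under
  their product, the rotation by \<open>2\<pi>\<gamma>\<close>. As \<open>\<gamma>\<close> is irrational, boundedly many powers of this
  rotation come close to every rotation; rotations near the identity move \<open>K\<^sub>n\<close> little, uniformly in
  \<open>n\<close>, because the neighbourhood of a symmetral lies in the symmetral of the neighbourhood
  (\<open>steiner_thicken\<close>). So \<open>K\<^sub>n\<close> is almost invariant under all rotations, and being almost fixed by one \<open>S\<^sub>v\<close>
  it is almost fixed by all.
\<close>

section \<open>Symmetrals as sets\<close>

lemma outer_measure_le:
  assumes "A \<subseteq> B" "B \<in> sets M" shows "outer_measure_of M A \<le> emeasure M B"
  using outer_measure_of_mono[OF assms(1), of M] assms(2) by simp

lemma emeasure_lebesgue_shift: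
  fixes B :: "'a::euclidean_space set"
  assumes "B \<in> sets lebesgue"
  shows "(\<lambda>x. x + s) ` B \<in> sets lebesgue" "emeasure lebesgue ((\<lambda>x. x + s) ` B) = emeasure lebesgue B"
proof -
  have eq: "(\<lambda>x. x + s) ` B = (+) s ` B" by (auto simp: add.commute)
  show "(\<lambda>x. x + s) ` B \<in> sets lebesgue"
    unfolding eq using assms by (rule lebesgue_sets_translation)
  show "emeasure lebesgue ((\<lambda>x. x + s) ` B) = emeasure lebesgue B"
    unfolding eq using emeasure_lebesgue_affine[of 1 s B] by (simp add: image_def add.commute)
qed

lemma outer_measure_shift_le:
  fixes A :: "real set"
  shows "outer_measure_of lebesgue ((\<lambda>x. x + s) ` A) \<le> outer_measure_of lebesgue A"
proof -
  obtain E where E: "E \<in> sets lebesgue" "A \<subseteq> E" "outer_measure_of lebesgue A = emeasure lebesgue E"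
    using outer_measure_of_attain[of A lebesgue] by auto
  show ?thesis
    unfolding E(3) emeasure_lebesgue_shift(2)[OF E(1), of s, symmetric]
    by (rule outer_measure_le) (use E emeasure_lebesgue_shift(1) in auto)
qed

text \<open>
  The length depends only on the line, so a point of the symmetral need not be written
  relative to its foot on the orthogonal line; this makes \<open>mem_steiner\<close> below
  free of any decomposition.
\<close>

lemma section_length_shift:
  "section_length u M (x + of_real s * u) = section_length u M x"
proof -
  have le: "section_length u M (y + of_real r * u) \<le> section_length u M y" for y r
  proof -
    have "{t. y + of_real r * u + of_real t * u \<in> M} = (\<lambda>t. t + - r) ` {t. y + of_real t * u \<in> M}"
      by (force simp: algebra_simps image_iff)
    then show ?thesis
      unfolding section_length_def by (metis outer_measure_shift_le)
  qed
  show ?thesis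
    using le[of "x + of_real s * u" "-s"] le[of x s] by (simp add: algebra_simps order_antisym)
qed

lemma inner_scaleR_unit:
  fixes u :: complex assumes "norm u = 1"
  shows "(of_real t * u) \<bullet> u = t"
  using assms by (simp add: scaleR_conv_of_real[symmetric] dot_square_norm)

lemma mem_steiner:
  assumes u: "norm u = 1"
  shows "z \<in> steiner u M \<longleftrightarrow>
    (\<exists>t::real. z + of_real t * u \<in> M) \<and> ennreal (2 * \<bar>z \<bullet> u\<bar>) \<le> section_length u M z"
proof
  assume "z \<in> steiner u M"
  then obtain x t t' where x: "x \<bullet> u = 0" "x + of_real t' * u \<in> M" "z = x + of_real t * u"
    "ennreal (2 * \<bar>t\<bar>) \<le> section_length u M x"
    unfolding steiner_def by blast
  have "z + of_real (t' - t) * u \<in> M" using x by (simp add: algebra_simps)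
  moreover have "z \<bullet> u = t" using x u by (simp add: inner_add_left inner_scaleR_unit)
  ultimately show "(\<exists>t::real. z + of_real t * u \<in> M) \<and> ennreal (2 * \<bar>z \<bullet> u\<bar>) \<le> section_length u M z"
    using x by (metis section_length_shift)
next
  assume *: "(\<exists>t::real. z + of_real t * u \<in> M) \<and> ennreal (2 * \<bar>z \<bullet> u\<bar>) \<le> section_length u M z"
  then obtain t where t: "z + of_real t * u \<in> M" by blast
  define x where "x = z - of_real (z \<bullet> u) * u"
  have "x \<bullet> u = 0" using u by (simp add: x_def inner_diff_left inner_scaleR_unit)
  moreover have "x + of_real (z \<bullet> u + t) * u \<in> M" using t by (simp add: x_def algebra_simps)
  moreover have z: "z = x + of_real (z \<bullet> u) * u" by (simp add: x_def)
  moreover have "section_length u M z = section_length u M x"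
    by (subst z) (rule section_length_shift)
  ultimately show "z \<in> steiner u M"
    unfolding steiner_def using * by (intro UN_I[of x]) (metis (mono_tags, lifting) mem_Collect_eq, metis (mono_tags, lifting) mem_Collect_eq)
qed

lemma section_length_mono: "M \<subseteq> N \<Longrightarrow> section_length u M x \<le> section_length u N x"
  unfolding section_length_def by (intro outer_measure_of_mono) auto

lemma steiner_mono:
  assumes "norm u = 1" "M \<subseteq> N" shows "steiner u M \<subseteq> steiner u N"
proof
  fix z assume "z \<in> steiner u M"
  then show "z \<in> steiner u N"
    using assms(2) order_trans[OF _ section_length_mono[OF assms(2)]]
    unfolding mem_steiner[OF assms(1)] by blast
qed

lemma steiner_rotate:
  assumes c: "norm c = 1" and u: "norm u = 1"
  shows "steiner (c * u) ((*) c ` M) = (*) c ` steiner u M"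
proof -
  have c0: "c \<noteq> 0" using c by auto
  have img: "c * w \<in> (*) c ` A \<longleftrightarrow> w \<in> A" for w A using c0 by auto
  have inn: "(c * w) \<bullet> (c * u) = w \<bullet> u" for w
  proof -
    have "(c * w) \<bullet> (c * u) = ((Re c)\<^sup>2 + (Im c)\<^sup>2) * (w \<bullet> u)"
      by (simp add: inner_complex_def power2_eq_square algebra_simps)
    then show ?thesis using c by (simp add: cmod_def)
  qed
  have cu: "norm (c * u) = 1" using c u by (simp add: norm_mult)
  have sec: "c * w + of_real t * (c * u) \<in> (*) c ` M \<longleftrightarrow> w + of_real t * u \<in> M" for w t
    using img[of "w + of_real t * u" M] by (simp add: algebra_simps)
  have *: "c * w \<in> steiner (c * u) ((*) c ` M) \<longleftrightarrow> w \<in> steiner u M" for w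
    unfolding mem_steiner[OF cu] mem_steiner[OF u] sec inn section_length_def ..
  show ?thesis
  proof (rule set_eqI)
    fix z
    obtain w where z: "z = c * w" using c0 by (metis nonzero_mult_div_cancel_left times_divide_eq_right)
    show "z \<in> steiner (c * u) ((*) c ` M) \<longleftrightarrow> z \<in> (*) c ` steiner u M"
      unfolding z img * ..
  qed
qed

text \<open>
  A symmetral meets each line in a centred segment: sliding along the direction towards the
  origin never leaves it. Both the reflection symmetry and the pair argument for the stability
  of balls are instances.
\<close>

lemma steiner_slide:
  assumes u: "norm u = 1" and z: "z \<in> steiner u M" and le: "norm (z + of_real h * u) \<le> norm z"
  shows "z + of_real h * u \<in> steiner u M"
proof -
  have eq: "(z + of_real h * u) \<bullet> u = z \<bullet> u + h"
    using u by (simp add: inner_add_left inner_scaleR_unit)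
  have "(norm (z + h *\<^sub>R u))\<^sup>2 \<le> (norm z)\<^sup>2"
    using le by (intro power_mono) (auto simp: scaleR_conv_of_real)
  then have "(z \<bullet> u + h)\<^sup>2 \<le> (z \<bullet> u)\<^sup>2"
    using u by (simp add: power2_norm_eq_inner inner_add_left inner_add_right inner_commute
        power2_eq_square algebra_simps norm_eq_sqrt_inner)
  then have "\<bar>z \<bullet> u + h\<bar> \<le> \<bar>z \<bullet> u\<bar>" by (simp add: abs_le_square_iff)
  then have "ennreal (2 * \<bar>(z + of_real h * u) \<bullet> u\<bar>) \<le> ennreal (2 * \<bar>z \<bullet> u\<bar>)"
    unfolding eq by (intro ennreal_leI) simp
  moreover obtain t where "z + of_real t * u \<in> M" using z u by (auto simp: mem_steiner)
  then have "(z + of_real h * u) + of_real (t - h) * u \<in> M" by (simp add: algebra_simps)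
  ultimately show ?thesis
    using z u unfolding mem_steiner[OF u] section_length_shift by (meson order_trans)
qed

text \<open>
  The map is the reflection in the line orthogonal to \<open>u\<close>; it slides
  \<open>z\<close> along \<open>u\<close> by \<open>-2 (z \<bullet> u)\<close> without
  changing its norm.
\<close>

lemma steiner_reflect:
  assumes u: "norm u = 1" and z: "z \<in> steiner u M"
  shows "- u\<^sup>2 * cnj z \<in> steiner u M"
proof -
  have "u * cnj u = 1" using u by (simp add: complex_norm_square[symmetric])
  have "of_real (2 * (z \<bullet> u)) = z * cnj u + cnj z * u"
    by (auto simp: complex_eq_iff inner_complex_def algebra_simps)
  then have "of_real (2 * (z \<bullet> u)) * u = z * (u * cnj u) + u\<^sup>2 * cnj z"
    by (simp add: algebra_simps power2_eq_square)
  then have eq: "- u\<^sup>2 * cnj z = z + of_real (- 2 * (z \<bullet> u)) * u"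
    using \<open>u * cnj u = 1\<close> by (simp add: algebra_simps)
  have "norm (- u\<^sup>2 * cnj z) = norm z" using u by (simp add: norm_mult norm_power)
  then show ?thesis unfolding eq by (rule steiner_slide[OF u z, OF eq_refl])
qed

lemma norm_square_decompose:
  fixes u z :: complex
  assumes "norm u = 1"
  shows "(norm (z + of_real t * u))\<^sup>2 = (norm (z - of_real (z \<bullet> u) * u))\<^sup>2 + (z \<bullet> u + t)\<^sup>2"
proof -
  have "u \<bullet> u = 1" using assms by (simp add: dot_square_norm)
  then have "(norm (z + t *\<^sub>R u))\<^sup>2 = (norm (z - (z \<bullet> u) *\<^sub>R u))\<^sup>2 + (z \<bullet> u + t)\<^sup>2"
    unfolding power2_norm_eq_inner
    by (simp add: inner_add_left inner_add_right inner_diff_left inner_diff_right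
        inner_commute power2_eq_square algebra_simps)
  then show ?thesis by (simp add: scaleR_conv_of_real)
qed

lemma steiner_cball_subset:
  assumes u: "norm u = 1" and R: "R \<ge> 0"
  shows "steiner u (cball 0 R) \<subseteq> cball 0 R"
proof
  fix z assume "z \<in> steiner u (cball 0 R)"
  then obtain t where t: "norm (z + of_real t * u) \<le> R"
    and le: "ennreal (2 * \<bar>z \<bullet> u\<bar>) \<le> section_length u (cball 0 R) z"
    using u by (auto simp: mem_steiner)
  define p where "p = (norm (z - of_real (z \<bullet> u) * u))\<^sup>2"
  have sq: "norm (z + of_real t * u) \<le> R \<longleftrightarrow> (z \<bullet> u + t)\<^sup>2 \<le> R\<^sup>2 - p" for t
  proof -
    have "norm (z + of_real t * u) \<le> R \<longleftrightarrow> (norm (z + of_real t * u))\<^sup>2 \<le> R\<^sup>2"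
      using R by (simp add: power_mono_iff)
    then show ?thesis unfolding norm_square_decompose[OF u, of z t] p_def by auto
  qed
  have p: "R\<^sup>2 - p \<ge> 0" using t sq[of t] by (smt (verit) zero_le_power2)
  define q where "q = sqrt (R\<^sup>2 - p)"
  have q: "q \<ge> 0" "q\<^sup>2 = R\<^sup>2 - p" using p by (auto simp: q_def)
  have "section_length u (cball 0 R) z \<le> emeasure lebesgue {- q - z \<bullet> u .. q - z \<bullet> u}"
    unfolding section_length_def
  proof (rule outer_measure_le)
    show "{t. z + of_real t * u \<in> cball 0 R} \<subseteq> {- q - z \<bullet> u..q - z \<bullet> u}"
    proof
      fix t assume "t \<in> {t. z + of_real t * u \<in> cball 0 R}"
      then have "\<bar>z \<bullet> u + t\<bar> \<le> \<bar>q\<bar>"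
        using sq[of t] q(2) by (simp only: abs_le_square_iff mem_Collect_eq mem_cball_0)
      then show "t \<in> {- q - z \<bullet> u..q - z \<bullet> u}" using q by auto
    qed
  qed auto
  also have "\<dots> = ennreal (2 * q)" using q by simp
  finally have "ennreal (2 * \<bar>z \<bullet> u\<bar>) \<le> ennreal (2 * q)" using le by simp
  then have "\<bar>z \<bullet> u\<bar> \<le> \<bar>q\<bar>" using q by (simp add: ennreal_le_iff)
  then have "(z \<bullet> u + 0)\<^sup>2 \<le> R\<^sup>2 - p" unfolding abs_le_square_iff using q(2) by simp
  then show "z \<in> cball 0 R" using sq[of 0] by simp
qed

text \<open>
  One-dimensional Brunn-Minkowski inequality for an interval. Fix a point \<open>a\<close> of
  \<open>A\<close>; the thickened set contains the interval of radius \<open>s\<close> around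
  \<open>a\<close>, the part of \<open>A\<close> left of \<open>a\<close> moved left by
  \<open>s\<close>, and the part right of \<open>a\<close> moved right by \<open>s\<close>,
  and these three pieces are disjoint.
\<close>

lemma outer_measure_thicken:
  fixes A :: "real set"
  assumes "A \<noteq> {}" "s \<ge> 0"
  shows "outer_measure_of lebesgue A + ennreal (2 * s)
       \<le> outer_measure_of lebesgue {t. \<exists>a\<in>A. \<bar>t - a\<bar> \<le> s}" (is "_ \<le> outer_measure_of _ ?X")
proof -
  obtain E where E: "E \<in> sets lebesgue" "?X \<subseteq> E" "outer_measure_of lebesgue ?X = emeasure lebesgue E"
    using outer_measure_of_attain[of ?X lebesgue] by auto
  obtain a where a: "a \<in> A" using assms by auto
  define L where "L = E \<inter> {..<a - s}"
  define G where "G = E \<inter> {a + s<..}"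
  have [measurable]: "L \<in> sets lebesgue" "G \<in> sets lebesgue"
    using E by (auto simp: L_def G_def)
  have disj: "L \<inter> {a - s..a + s} = {}" "(L \<union> {a - s..a + s}) \<inter> G = {}"
    using assms by (auto simp: L_def G_def)
  have "emeasure lebesgue L + ennreal (2 * s) + emeasure lebesgue G
      = emeasure lebesgue L + emeasure lebesgue {a - s..a + s} + emeasure lebesgue G"
    using assms by simp
  also have "\<dots> = emeasure lebesgue (L \<union> {a - s..a + s} \<union> G)"
    using disj by (subst plus_emeasure, simp, simp, simp, subst plus_emeasure) auto
  also have "\<dots> \<le> emeasure lebesgue E"
  proof (rule emeasure_mono)
    have "{a - s..a + s} \<subseteq> ?X" using a by (auto intro!: bexI[of _ a])
    then show "L \<union> {a - s..a + s} \<union> G \<subseteq> E" using E(2) by (auto simp: L_def G_def)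
  qed (use E in auto)
  finally have 1: "emeasure lebesgue L + ennreal (2 * s) + emeasure lebesgue G \<le> emeasure lebesgue E" .
  have "outer_measure_of lebesgue A
     \<le> emeasure lebesgue ((\<lambda>x. x + s) ` L \<union> {a} \<union> (\<lambda>x. x + -s) ` G)"
  proof (rule outer_measure_le)
    show "A \<subseteq> (\<lambda>x. x + s) ` L \<union> {a} \<union> (\<lambda>x. x + - s) ` G"
    proof
      fix x assume x: "x \<in> A"
      then have mem: "x - s \<in> E" "x + s \<in> E" using E(2) assms by force+
      consider "x < a" | "x = a" | "x > a" by linarith
      then show "x \<in> (\<lambda>x. x + s) ` L \<union> {a} \<union> (\<lambda>x. x + - s) ` G"
      proof cases
        case 1 then have "x - s \<in> L" using mem by (simp add: L_def)
        then show ?thesis by force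
      next
        case 3 then have "x + s \<in> G" using mem by (simp add: G_def)
        then show ?thesis by force
      qed auto
    qed
    show "(\<lambda>x. x + s) ` L \<union> {a} \<union> (\<lambda>x. x + - s) ` G \<in> sets lebesgue"
      by (intro sets.Un emeasure_lebesgue_shift) auto
  qed
  also have "\<dots> \<le> emeasure lebesgue ((\<lambda>x. x + s) ` L \<union> {a}) + emeasure lebesgue ((\<lambda>x. x + -s) ` G)"
    by (intro emeasure_subadditive sets.Un emeasure_lebesgue_shift) auto
  also have "\<dots> \<le> emeasure lebesgue ((\<lambda>x. x + s) ` L) + emeasure lebesgue {a} + emeasure lebesgue ((\<lambda>x. x + -s) ` G)"
    by (intro add_mono emeasure_subadditive emeasure_lebesgue_shift) auto
  also have "\<dots> = emeasure lebesgue L + emeasure lebesgue G"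
  proof -
    have "emeasure lebesgue {a} = 0" by simp
    then show ?thesis
      using emeasure_lebesgue_shift(2)[of L s] emeasure_lebesgue_shift(2)[of G "-s"]
      by (simp del: emeasure_completion)
  qed
  finally have "outer_measure_of lebesgue A + ennreal (2 * s) \<le> emeasure lebesgue L + emeasure lebesgue G + ennreal (2 * s)"
    by (rule add_right_mono)
  also have "\<dots> \<le> emeasure lebesgue E" using 1 by (simp add: ac_simps)
  finally show ?thesis unfolding E(3) .
qed

text \<open>
  The \<open>e\<close>-neighbourhood of the symmetral lies in the symmetral of the
  \<open>e\<close>-neighbourhood. Split the displacement into a component \<open>s\<close>
  along \<open>u\<close> and an orthogonal component: the section of the neighbourhood over
  the displaced line contains the old section thickened by \<open>\<bar>s\<bar>\<close>, hence
  is longer by at least \<open>2 \<bar>s\<bar>\<close>. This is the source of all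
  equicontinuity in the proof.
\<close>

lemma steiner_thicken:
  assumes u: "norm u = 1" and z: "z \<in> steiner u M" and d: "dist z z' < e"
  shows "z' \<in> steiner u (\<Union>x\<in>M. ball x e)" (is "_ \<in> steiner u ?N")
proof -
  define d where "d = z' - z"
  define s where "s = d \<bullet> u"
  define y where "y = d - of_real s * u"
  have z': "z' = (z + y) + of_real s * u" by (simp add: y_def d_def)
  have nd: "norm d < e" using d by (simp add: d_def dist_norm norm_minus_commute)
  obtain t where t: "z + of_real t * u \<in> M" using z u by (auto simp: mem_steiner)
  have close: "norm (y + of_real r * u) < e" if "\<bar>r\<bar> \<le> \<bar>s\<bar>" for r
  proof -
    have "(norm (y + of_real r * u))\<^sup>2 = (norm y)\<^sup>2 + r\<^sup>2"
      using norm_square_decompose[OF u, of d "r - s"] by (simp add: y_def s_def algebra_simps)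
    also have "\<dots> \<le> (norm y)\<^sup>2 + s\<^sup>2" using that by (simp add: abs_le_square_iff)
    also have "\<dots> = (norm d)\<^sup>2"
      using norm_square_decompose[OF u, of d 0] by (simp add: y_def s_def)
    finally have "norm (y + of_real r * u) \<le> norm d"
      by (rule power2_le_imp_le[OF _ norm_ge_zero])
    then show ?thesis using nd by simp
  qed
  define A where "A = {t. z + of_real t * u \<in> M}"
  have sub: "{t. \<exists>a\<in>A. \<bar>t - a\<bar> \<le> \<bar>s\<bar>} \<subseteq> {t. (z + y) + of_real t * u \<in> ?N}"
  proof clarify
    fix r a assume a: "a \<in> A" "\<bar>r - a\<bar> \<le> \<bar>s\<bar>"
    have "dist (z + of_real a * u) (z + y + of_real r * u) = norm (y + of_real (r - a) * u)"
      by (simp add: dist_norm norm_minus_commute algebra_simps)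
    then have "z + y + of_real r * u \<in> ball (z + of_real a * u) e" using close[OF a(2)] by simp
    then show "(z + y) + of_real r * u \<in> ?N" using a by (auto simp: A_def)
  qed
  have "ennreal (2 * \<bar>z' \<bullet> u\<bar>) \<le> ennreal (2 * \<bar>z \<bullet> u\<bar>) + ennreal (2 * \<bar>s\<bar>)"
    by (subst ennreal_plus[symmetric], simp, simp, rule ennreal_leI)
       (use inner_add_left[of z d u] abs_triangle_ineq[of "z \<bullet> u" s] in \<open>simp add: s_def d_def\<close>)
  also have "\<dots> \<le> outer_measure_of lebesgue A + ennreal (2 * \<bar>s\<bar>)"
    using z u by (intro add_right_mono) (simp add: mem_steiner A_def section_length_def)
  also have "\<dots> \<le> outer_measure_of lebesgue {t. \<exists>a\<in>A. \<bar>t - a\<bar> \<le> \<bar>s\<bar>}"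
    by (rule outer_measure_thicken) (use t in \<open>auto simp: A_def\<close>)
  also have "\<dots> \<le> section_length u ?N (z + y)"
    unfolding section_length_def by (rule outer_measure_of_mono[OF sub])
  also have "\<dots> = section_length u ?N z'" unfolding z' section_length_shift ..
  finally have "ennreal (2 * \<bar>z' \<bullet> u\<bar>) \<le> section_length u ?N z'" .
  moreover have "z' + of_real (t - s) * u \<in> ?N"
  proof -
    have "t \<in> {t. \<exists>a\<in>A. \<bar>t - a\<bar> \<le> \<bar>s\<bar>}" using t by (auto simp: A_def intro!: bexI[of _ t])
    then have "(z + y) + of_real t * u \<in> ?N" using sub by auto
    then show ?thesis unfolding z' by (simp add: algebra_simps)
  qed
  ultimately show ?thesis unfolding mem_steiner[OF u] by blast
qed

section \<open>Plane Lebesgue measure: isometries and sections\<close>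

lemma Complex_measurable [measurable (raw)]:
  assumes [measurable]: "f \<in> borel_measurable M" "g \<in> borel_measurable M"
  shows "(\<lambda>x. Complex (f x) (g x)) \<in> borel_measurable M"
  unfolding Complex_eq by measurable

lemma Re_measurable [measurable]: "Re \<in> borel_measurable borel"
  and Im_measurable [measurable]: "Im \<in> borel_measurable borel"
  by (auto intro!: borel_measurable_continuous_onI continuous_intros)

text \<open>
  Identifies the plane measure with that of \<open>real ^ 2\<close>, from which invariance
  under isometries is inherited.
\<close>

lemma lborel_complex_vec: "distr lborel borel (\<lambda>v::real^2. Complex (v $ 1) (v $ 2)) = lborel"
proof (rule lborel_eqI[symmetric])
  fix l u :: complex assume le: "\<And>b. b \<in> Basis \<Longrightarrow> l \<bullet> b \<le> u \<bullet> b"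
  have [measurable]: "(\<lambda>v::real^2. v $ i) \<in> borel_measurable borel" for i
    by (intro borel_measurable_continuous_onI continuous_intros)
  have vim: "(\<lambda>v::real^2. Complex (v $ 1) (v $ 2)) -` box l u
      = box (vector [Re l, Im l]) (vector [Re u, Im u])"
    by (auto simp: mem_box_cart forall_2 vector_2 in_box_complex_iff)
  have le': "Re l \<le> Re u" "Im l \<le> Im u" using le[of 1] le[of \<i>] by (auto simp: Basis_complex_def)
  have B: "(Basis :: (real^2) set) = {axis 1 1, axis 2 1}"
    by (auto simp: Basis_vec_def UNIV_2)
  have ne: "axis 1 1 \<noteq> (axis 2 1 :: real^2)" by (simp add: axis_eq_axis)
  have "emeasure lborel (box (vector [Re l, Im l] :: real^2) (vector [Re u, Im u]))
     = ennreal ((Re u - Re l) * (Im u - Im l))"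
    by (subst emeasure_lborel_box) (use le' ne in \<open>auto simp: B inner_axis vector_2\<close>)
  also have "(Re u - Re l) * (Im u - Im l) = (\<Prod>b\<in>Basis. (u - l) \<bullet> b)"
    by (simp add: Basis_complex_def)
  finally show "emeasure (distr lborel borel (\<lambda>v::real^2. Complex (v $ 1) (v $ 2))) (box l u)
     = ennreal (\<Prod>b\<in>Basis. (u - l) \<bullet> b)"
    by (subst emeasure_distr) (auto simp: vim)
qed simp

text \<open>
  The pair consists of the imaginary part and the real part, in this order, so that the inner
  integral of Tonelli's theorem runs over horizontal lines, the sections of the symmetrization
  in direction \<open>1\<close>.
\<close>

lemma lborel_complex_prod:
  "distr (lborel \<Otimes>\<^sub>M lborel) borel (\<lambda>(s, t). Complex t s) = lborel"
proof (rule lborel_eqI[symmetric])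
  fix l u :: complex assume le: "\<And>b. b \<in> Basis \<Longrightarrow> l \<bullet> b \<le> u \<bullet> b"
  have vim: "(\<lambda>(s, t). Complex t s) -` box l u = {Im l<..<Im u} \<times> {Re l<..<Re u}"
    by (auto simp: in_box_complex_iff)
  have le': "Re l \<le> Re u" "Im l \<le> Im u" using le[of 1] le[of \<i>] by (auto simp: Basis_complex_def)
  have "emeasure (distr (lborel \<Otimes>\<^sub>M lborel) borel (\<lambda>(s, t). Complex t s)) (box l u)
     = emeasure (lborel \<Otimes>\<^sub>M lborel) ({Im l<..<Im u} \<times> {Re l<..<Re u})"
    by (subst emeasure_distr) (auto simp: vim space_pair_measure)
  also have "\<dots> = ennreal ((Im u - Im l) * (Re u - Re l))"
    using le' by (simp add: lborel.emeasure_pair_measure_Times ennreal_mult)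
  also have "(Im u - Im l) * (Re u - Re l) = (\<Prod>b\<in>Basis. (u - l) \<bullet> b)"
    by (simp add: Basis_complex_def)
  finally show "emeasure (distr (lborel \<Otimes>\<^sub>M lborel) borel (\<lambda>(s, t). Complex t s)) (box l u)
     = ennreal (\<Prod>b\<in>Basis. (u - l) \<bullet> b)" .
qed simp

lemma nn_integral_complex_sections:
  assumes [measurable]: "f \<in> borel_measurable borel"
  shows "(\<integral>\<^sup>+z. f z \<partial>lborel) = (\<integral>\<^sup>+s. (\<integral>\<^sup>+t. f (Complex t s) \<partial>lborel) \<partial>lborel)"
proof -
  have "(\<integral>\<^sup>+z. f z \<partial>lborel) = (\<integral>\<^sup>+z. f z \<partial>distr (lborel \<Otimes>\<^sub>M lborel) borel (\<lambda>(s, t). Complex t s))"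
    by (simp add: lborel_complex_prod)
  also have "\<dots> = (\<integral>\<^sup>+p. f (Complex (snd p) (fst p)) \<partial>(lborel \<Otimes>\<^sub>M lborel))"
    by (subst nn_integral_distr) (auto simp: case_prod_beta)
  also have "\<dots> = (\<integral>\<^sup>+s. (\<integral>\<^sup>+t. f (Complex t s) \<partial>lborel) \<partial>lborel)"
    by (subst lborel.nn_integral_fst[symmetric]) auto
  finally show ?thesis .
qed

lemma lborel_distr_orthogonal:
  fixes f :: "complex \<Rightarrow> complex"
  assumes f: "orthogonal_transformation f"
  shows "distr lborel borel f = lborel"
proof (rule lborel_eqI[symmetric])
  fix l u :: complex assume le: "\<And>b. b \<in> Basis \<Longrightarrow> l \<bullet> b \<le> u \<bullet> b"
  define f' where "f' = inv f"
  have f': "orthogonal_transformation f'" unfolding f'_def by (rule orthogonal_transformation_inv[OF f])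
  have ff': "f (f' z) = z" "f' (f z) = z" for z
    using orthogonal_transformation_bij[OF f] by (simp_all add: f'_def bij_is_surj surj_f_inv_f bij_is_inj)
  have [measurable]: "f \<in> borel_measurable borel"
    using orthogonal_transformation_linear[OF f]
    by (intro borel_measurable_continuous_onI linear_continuous_on) (simp add: linear_conv_bounded_linear)
  define \<phi> where "\<phi> = (\<lambda>v::real^2. Complex (v $ 1) (v $ 2))"
  define \<psi> where "\<psi> = (\<lambda>z. vector [Re z, Im z] :: real^2)"
  define \<rho> where "\<rho> = (\<lambda>v. \<psi> (f' (\<phi> v)))"
  have [measurable]: "(\<lambda>v::real^2. v $ i) \<in> borel_measurable borel" for i
    by (intro borel_measurable_continuous_onI continuous_intros)
  have \<phi>[measurable]: "\<phi> \<in> borel_measurable borel" by (simp add: \<phi>_def)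
  have inv: "\<phi> (\<psi> z) = z" "\<psi> (\<phi> v) = v" for z v
    by (auto simp: \<phi>_def \<psi>_def vec_eq_iff forall_2 vector_2)
  have nrm: "norm (\<phi> v) = norm v" for v
    by (simp add: \<phi>_def cmod_def norm_vec_def L2_set_def UNIV_2)
  have nrm': "norm (\<psi> z) = norm z" for z using nrm[of "\<psi> z"] inv by simp
  have "linear \<phi>" "linear \<psi>"
    by (rule linearI; simp add: \<phi>_def \<psi>_def vec_eq_iff forall_2 vector_2 complex_eq_iff)+
  then have lin: "linear \<rho>"
    unfolding \<rho>_def using linear_compose[OF linear_compose[OF _ orthogonal_transformation_linear[OF f']]]
    by (simp add: o_def)
  have orth: "orthogonal_transformation \<rho>"
    unfolding orthogonal_transformation
    using lin orthogonal_transformation_norm[OF f'] by (auto simp: \<rho>_def nrm nrm')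
  have em: "emeasure lborel S = emeasure lborel (\<phi> -` S)" if "S \<in> sets borel" for S
  proof -
    have "emeasure lborel S = emeasure (distr lborel borel \<phi>) S"
      by (simp add: \<phi>_def lborel_complex_vec)
    also have "\<dots> = emeasure lborel (\<phi> -` S)" using that by (simp add: emeasure_distr)
    finally show ?thesis .
  qed
  have vb: "f -` box l u \<in> sets borel"
    using measurable_sets[of f borel borel "box l u"] by simp
  have img: "\<phi> -` (f -` box l u) = \<rho> ` (\<phi> -` box l u)"
  proof (intro set_eqI iffI)
    fix v assume "v \<in> \<phi> -` (f -` box l u)"
    moreover have "v = \<rho> (\<psi> (f (\<phi> v)))" by (simp add: \<rho>_def inv ff')
    ultimately show "v \<in> \<rho> ` (\<phi> -` box l u)" by (auto simp: inv)
  qed (auto simp: \<rho>_def inv ff')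
  have "\<phi> -` box l u = box (\<psi> l) (\<psi> u)"
    by (auto simp: \<phi>_def \<psi>_def mem_box_cart forall_2 vector_2 in_box_complex_iff)
  then have lm: "\<phi> -` box l u \<in> lmeasurable" by simp
  have "emeasure lebesgue (\<rho> ` (\<phi> -` box l u)) = emeasure lebesgue (\<phi> -` box l u)"
    using measurable_orthogonal_image[OF orth lm] measure_orthogonal_image[OF orth lm] lm
    by (metis emeasure_eq_measure2)
  moreover have "\<phi> -` (f -` box l u) \<in> sets borel" "\<phi> -` box l u \<in> sets borel"
    using measurable_sets[OF \<phi>, of "f -` box l u"] measurable_sets[OF \<phi>, of "box l u"] vb by auto
  ultimately have "emeasure lborel (f -` box l u) = emeasure lborel (box l u)"
    using vb by (simp add: em img)
  also have "\<dots> = ennreal (\<Prod>b\<in>Basis. (u - l) \<bullet> b)" using le by simp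
  finally show "emeasure (distr lborel borel (f)) (box l u) = ennreal (\<Prod>b\<in>Basis. (u - l) \<bullet> b)"
    by (simp add: emeasure_distr)
qed simp

lemma lebesgue_distr_orthogonal:
  fixes f :: "complex \<Rightarrow> complex"
  assumes f: "orthogonal_transformation f"
  shows "f \<in> lebesgue \<rightarrow>\<^sub>M lebesgue" "distr lebesgue lebesgue f = lebesgue"
proof -
  have cm: "complete_measure (lebesgue :: complex measure)" ..
  have m: "f \<in> lebesgue \<rightarrow>\<^sub>M lborel"
    using orthogonal_transformation_linear[OF f]
    by (intro measurable_completion)
       (auto intro!: borel_measurable_continuous_onI linear_continuous_on simp: linear_conv_bounded_linear)
  have "distr lborel lborel f = distr lborel borel f"
    by (rule distr_cong) auto
  then have d: "distr lebesgue lborel f = lborel"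
    using m by (subst distr_completion)
      (use orthogonal_transformation_linear[OF f] in \<open>auto intro!: borel_measurable_continuous_onI
        linear_continuous_on simp: linear_conv_bounded_linear lborel_distr_orthogonal[OF f]\<close>)
  show "f \<in> lebesgue \<rightarrow>\<^sub>M lebesgue"
    by (rule complete_measure.measurable_completion2[OF cm m]) (simp add: d)
  show "distr lebesgue lebesgue f = lebesgue"
    using complete_measure.completion_distr_eq[OF cm m] by (simp add: d)
qed

lemma lebesgue_orthogonal_image:
  fixes f :: "complex \<Rightarrow> complex"
  assumes f: "orthogonal_transformation f" and S: "S \<in> sets lebesgue"
  shows "f ` S \<in> sets lebesgue" "emeasure lebesgue (f ` S) = emeasure lebesgue S"
proof -
  have f': "orthogonal_transformation (inv f)" by (rule orthogonal_transformation_inv[OF f])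
  have eq: "f ` S = inv f -` S" 
    using orthogonal_transformation_bij[OF f] by (metis bij_imp_bij_inv bij_vimage_eq_inv_image inv_inv_eq)
  note m = lebesgue_distr_orthogonal[OF f']
  show "f ` S \<in> sets lebesgue"
    unfolding eq using measurable_sets[OF m(1) S] by simp
  have "emeasure lebesgue (inv f -` S) = emeasure (distr lebesgue lebesgue (inv f)) S"
    using emeasure_distr[OF m(1) S] by simp
  then show "emeasure lebesgue (f ` S) = emeasure lebesgue S"
    unfolding eq m(2) .
qed

lemma lmeasurable_orthogonal_image:
  fixes f :: "complex \<Rightarrow> complex"
  assumes "orthogonal_transformation f" "S \<in> lmeasurable"
  shows "f ` S \<in> lmeasurable" "measure lebesgue (f ` S) = measure lebesgue S"
  using lebesgue_orthogonal_image[OF assms(1), of S] assms(2) by (auto simp: fmeasurable_def measure_def)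

lemma orthogonal_rotation:
  fixes c :: complex
  assumes "norm c = 1" shows "orthogonal_transformation ((*) c)"
  unfolding orthogonal_transformation using assms
  by (auto intro!: linearI simp: norm_mult algebra_simps scaleR_conv_of_real)

lemma orthogonal_reflection:
  fixes u :: complex
  assumes "norm u = 1" shows "orthogonal_transformation (\<lambda>z. - u\<^sup>2 * cnj z)"
  unfolding orthogonal_transformation using assms
  by (auto intro!: linearI simp: norm_mult norm_power algebra_simps scaleR_conv_of_real)

lemma lebesgue_rotate:
  fixes c :: complex
  assumes "norm c = 1" "S \<in> sets lebesgue"
  shows "(*) c ` S \<in> sets lebesgue" "emeasure lebesgue ((*) c ` S) = emeasure lebesgue S"
  using lebesgue_orthogonal_image[OF orthogonal_rotation] assms by auto

lemma nn_integral_rotate: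
  assumes c: "norm c = 1" and f: "f \<in> borel_measurable lebesgue"
  shows "(\<integral>\<^sup>+z. f (c * z) \<partial>lebesgue) = (\<integral>\<^sup>+z. f z \<partial>(lebesgue :: complex measure))"
  using nn_integral_distr[OF lebesgue_distr_orthogonal(1)[OF orthogonal_rotation[OF c]], of f] f
  by (simp add: lebesgue_distr_orthogonal(2)[OF orthogonal_rotation[OF c]])

section \<open>Measure and energy of a symmetral\<close>

definition section_measure :: "complex set \<Rightarrow> real \<Rightarrow> ennreal" where
  "section_measure C s = emeasure lborel {t. Complex t s \<in> C}"

text \<open>
  A Borel version of \<open>steiner 1 C\<close>. It differs from the symmetral in that lines
  meeting \<open>C\<close> in a null set are dropped: the set of such lines need not be
  measurable, but they contribute only points of the imaginary axis.
\<close>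

definition centred :: "complex set \<Rightarrow> complex set" where
  "centred C = {z. 0 < section_measure C (Im z) \<and> ennreal (2 * \<bar>Re z\<bar>) \<le> section_measure C (Im z)}"

lemma section_sets_borel:
  assumes "C \<in> sets borel" shows "{t. Complex t s \<in> C} \<in> sets borel"
proof -
  have "(\<lambda>t. Complex t s) -` C \<inter> space borel \<in> sets borel"
    by (rule measurable_sets[OF _ assms]) measurable
  then show ?thesis by (simp add: vimage_def)
qed

lemma nn_integral_section:
  assumes "C \<in> sets borel"
  shows "(\<integral>\<^sup>+t. indicator C (Complex t s) \<partial>lborel) = section_measure C s"
proof -
  have "(\<lambda>t. indicator C (Complex t s) :: ennreal) = indicator {t. Complex t s \<in> C}"
    by (auto simp: indicator_def fun_eq_iff)
  then show ?thesis
    using section_sets_borel[OF assms, of s]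
      nn_integral_indicator[of "{t. Complex t s \<in> C}" lborel]
    by (simp only: section_measure_def sets_lborel)
qed

lemma section_measure_measurable [measurable]:
  assumes [measurable]: "C \<in> sets borel"
  shows "section_measure C \<in> borel_measurable borel"
proof -
  have "(\<lambda>s. \<integral>\<^sup>+t. indicator C (Complex t s) \<partial>lborel) \<in> borel_measurable borel" by measurable
  then show ?thesis using nn_integral_section[OF assms] by simp
qed

lemma centred_borel [measurable]:
  assumes [measurable]: "C \<in> sets borel" shows "centred C \<in> sets borel"
  unfolding centred_def by measurable

lemma section_measure_centred:
  assumes C: "C \<in> sets borel" shows "section_measure (centred C) s = section_measure C s"
proof -
  let ?l = "section_measure C s"
  have sec: "{t. Complex t s \<in> centred C} = {t. 0 < ?l \<and> ennreal (2 * \<bar>t\<bar>) \<le> ?l}"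
    by (simp add: centred_def)
  consider "?l = 0" | "?l = \<infinity>" | r where "?l = ennreal r" "r > 0"
    by (cases ?l) (auto simp: less_le)
  then show ?thesis
  proof cases
    case 3
    have "{t. Complex t s \<in> centred C} = {- (r / 2)..r / 2}"
      unfolding sec using 3 by (auto simp: ennreal_le_iff abs_if split: if_splits)
    then show ?thesis using 3 unfolding section_measure_def[of "centred C"] by simp
  qed (auto simp: section_measure_def[of "centred C"] sec)
qed

text \<open>
  Corresponding sections have equal length, so a weight that is constant on each section has
  the same integral over both sets.
\<close>

lemma nn_integral_centred:
  assumes [measurable]: "C \<in> sets borel" "h \<in> borel_measurable borel"
  shows "(\<integral>\<^sup>+z. indicator (centred C) z * h (Im z) \<partial>lborel) = (\<integral>\<^sup>+z. indicator C z * h (Im z) \<partial>lborel)"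
proof -
  have *: "(\<integral>\<^sup>+z. indicator D z * h (Im z) \<partial>lborel) = (\<integral>\<^sup>+s. section_measure D s * h s \<partial>lborel)"
    if D[measurable]: "D \<in> sets borel" for D
    by (subst nn_integral_complex_sections, measurable)
       (simp add: nn_integral_multc nn_integral_section[OF D])
  show ?thesis by (simp add: * section_measure_centred)
qed

lemma emeasure_complex_sections:
  assumes [measurable]: "A \<in> sets borel"
  shows "emeasure lborel A = (\<integral>\<^sup>+s. section_measure A s \<partial>lborel)"
proof -
  have "emeasure lborel A = (\<integral>\<^sup>+z. indicator A z \<partial>lborel)" by simp
  also have "\<dots> = (\<integral>\<^sup>+s. section_measure A s \<partial>lborel)"
    by (subst nn_integral_complex_sections) (auto simp: nn_integral_section)
  finally show ?thesis .
qed

text \<open>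
  Write \<open>M\<close> as a Borel set \<open>C\<close> and a part of a Borel null set
  \<open>Z\<close>. Off the imaginary axis and off the null set of lines that meet
  \<open>Z\<close> in positive length, the section of \<open>M\<close> has the length of the
  section of \<open>C\<close>, and the two symmetrals agree.
\<close>

lemma steiner_1_AE:
  assumes M: "M \<in> sets lebesgue"
  obtains C where "C \<in> sets borel" "C \<subseteq> M" "AE z in lebesgue. z \<in> M \<longleftrightarrow> z \<in> C"
    "AE z in lebesgue. z \<in> steiner 1 M \<longleftrightarrow> z \<in> centred C"
proof -
  obtain C N Z where M_eq: "M = C \<union> N" and C: "C \<in> sets lborel" and N: "N \<subseteq> Z" and Z: "Z \<in> null_sets lborel"
    using sets_completionE[OF M] by metis
  have [measurable]: "C \<in> sets borel" "Z \<in> sets borel" using C Z by auto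
  define W where "W = {s. section_measure Z s \<noteq> 0}"
  have Wb[measurable]: "W \<in> sets borel" unfolding W_def by measurable
  have "(\<integral>\<^sup>+s. section_measure Z s \<partial>lborel) = 0"
    using emeasure_complex_sections[of Z] Z by auto
  then have "AE s in lborel. section_measure Z s = 0" by (subst (asm) nn_integral_0_iff_AE) auto
  then have Wn: "AE s in lborel. s \<notin> W" by (simp add: W_def)
  \<comment> \<open>Exceptional points: bad lines, and the imaginary axis, where the symmetral
    keeps single points.\<close>
  define V where "V = {z. Im z \<in> W} \<union> {z. Re z = 0}"
  have [measurable]: "V \<in> sets borel" unfolding V_def by measurable
  have "section_measure V s = 0" if "s \<notin> W" for s
  proof -
    have "{t. Complex t s \<in> V} = {0}" using that by (auto simp: V_def)
    then show ?thesis by (simp add: section_measure_def)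
  qed
  then have "AE s in lborel. section_measure V s = 0" using Wn by (auto elim: eventually_mono)
  then have "emeasure lborel V = 0"
    by (subst emeasure_complex_sections) (auto simp: nn_integral_0_iff_AE)
  then have Vn: "V \<in> null_sets lebesgue" by (intro null_sets_completionI null_setsI) auto
  have sec: "section_length 1 M z = section_measure C (Im z)" if "Im z \<notin> W" for z
  proof -
    have "section_length 1 M z = section_length 1 M (z + of_real (- Re z) * 1)"
      by (rule section_length_shift[symmetric])
    also have "\<dots> = outer_measure_of lebesgue {t. Complex t (Im z) \<in> M}"
    proof -
      have "z + of_real (- Re z) * 1 + of_real t * 1 = Complex t (Im z)" for t
        by (simp add: complex_eq_iff)
      then show ?thesis by (simp add: section_length_def)
    qed
    also have "\<dots> = section_measure C (Im z)"
    proof (rule antisym)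
      have "outer_measure_of lebesgue {t. Complex t (Im z) \<in> M}
          \<le> emeasure lebesgue ({t. Complex t (Im z) \<in> C} \<union> {t. Complex t (Im z) \<in> Z})"
        by (rule outer_measure_le) (use M_eq N section_sets_borel in \<open>auto intro!: sets.Un\<close>)
      also have "\<dots> = emeasure lborel ({t. Complex t (Im z) \<in> C} \<union> {t. Complex t (Im z) \<in> Z})"
        using section_sets_borel[of C] section_sets_borel[of Z] by simp
      also have "\<dots> \<le> section_measure C (Im z) + section_measure Z (Im z)"
        unfolding section_measure_def by (intro emeasure_subadditive) (auto intro: section_sets_borel)
      finally show "outer_measure_of lebesgue {t. Complex t (Im z) \<in> M} \<le> section_measure C (Im z)"
        using that by (simp add: W_def)
      have "section_measure C (Im z) = outer_measure_of lebesgue {t. Complex t (Im z) \<in> C}"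
        using section_sets_borel[of C] by (simp add: section_measure_def)
      also have "\<dots> \<le> outer_measure_of lebesgue {t. Complex t (Im z) \<in> M}"
        by (rule outer_measure_of_mono) (auto simp: M_eq)
      finally show "section_measure C (Im z) \<le> outer_measure_of lebesgue {t. Complex t (Im z) \<in> M}" .
    qed
    finally show ?thesis .
  qed
  have iff: "z \<in> steiner 1 M \<longleftrightarrow> z \<in> centred C" if z: "z \<notin> V" for z
  proof -
    have nz: "Re z \<noteq> 0" "Im z \<notin> W" using z by (auto simp: V_def)
    have "\<exists>t::real. z + of_real t * 1 \<in> M" if "0 < section_measure C (Im z)"
    proof -
      have "{t. Complex t (Im z) \<in> C} \<noteq> {}"
        using that unfolding section_measure_def by (metis emeasure_empty less_irrefl)
      then obtain t where "Complex t (Im z) \<in> C" by auto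
      moreover have "Complex t (Im z) = z + of_real (t - Re z) * 1" by (simp add: complex_eq_iff)
      ultimately show ?thesis unfolding M_eq by (metis UnI1)
    qed
    moreover have "0 < section_measure C (Im z)" if "ennreal (2 * \<bar>Re z\<bar>) \<le> section_measure C (Im z)"
      by (rule less_le_trans[OF _ that]) (use nz in simp)
    ultimately show ?thesis
      unfolding mem_steiner[of 1 z, simplified] centred_def using sec[OF nz(2)]
      by (auto simp: inner_complex_def)
  qed
  show ?thesis
  proof (rule that)
    show "AE z in lebesgue. z \<in> M \<longleftrightarrow> z \<in> C"
      by (rule AE_I'[OF null_sets_completionI[OF Z]]) (use M_eq N in auto)
    show "AE z in lebesgue. z \<in> steiner 1 M \<longleftrightarrow> z \<in> centred C"
      by (rule AE_I'[OF Vn]) (use iff in auto)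
  qed (auto simp: M_eq)
qed

lemma rotate_rotate_back:
  assumes "norm u = 1" shows "(*) u ` (*) (cnj u) ` M = M"
proof -
  have "u * cnj u = 1" using assms by (simp add: complex_norm_square[symmetric])
  then have "u * (cnj u * z) = z" for z by (simp add: mult.assoc[symmetric])
  then show ?thesis unfolding image_image by (simp only: image_ident)
qed

lemma steiner_eq_rotated:
  assumes "norm u = 1"
  shows "steiner u M = (*) u ` steiner 1 ((*) (cnj u) ` M)"
  using steiner_rotate[OF assms, of 1 "(*) (cnj u) ` M"] rotate_rotate_back[OF assms] by simp

lemma steiner_lebesgue:
  assumes u: "norm u = 1" and M: "M \<in> sets lebesgue"
  shows "steiner u M \<in> sets lebesgue" "emeasure lebesgue (steiner u M) = emeasure lebesgue M"
proof -
  define M' where "M' = (*) (cnj u) ` M"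
  have u': "norm (cnj u) = 1" using u by simp
  have M': "M' \<in> sets lebesgue" "emeasure lebesgue M' = emeasure lebesgue M"
    unfolding M'_def by (rule lebesgue_rotate[OF u' M])+
  obtain C where C[measurable]: "C \<in> sets borel" and AE: "AE z in lebesgue. z \<in> M' \<longleftrightarrow> z \<in> C"
    "AE z in lebesgue. z \<in> steiner 1 M' \<longleftrightarrow> z \<in> centred C"
    using steiner_1_AE[OF M'(1)] by metis
  have cm: "complete_measure (lebesgue :: complex measure)" ..
  have s: "steiner 1 M' \<in> sets lebesgue"
    by (rule complete_measure.in_sets_AE[OF cm, of "centred C"]) (use AE(2) in \<open>auto elim: eventually_mono\<close>)
  have "emeasure lebesgue (steiner 1 M') = emeasure lebesgue (centred C)"
    by (rule emeasure_eq_AE) (use AE(2) s in auto)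
  also have "\<dots> = emeasure lborel C"
    by (simp add: emeasure_complex_sections section_measure_centred)
  also have "\<dots> = emeasure lebesgue C" by simp
  also have "\<dots> = emeasure lebesgue M'"
    by (rule emeasure_eq_AE) (use AE(1) M' in \<open>auto elim: eventually_mono\<close>)
  finally have e: "emeasure lebesgue (steiner 1 M') = emeasure lebesgue M" by (simp only: M'(2))
  show "steiner u M \<in> sets lebesgue" "emeasure lebesgue (steiner u M) = emeasure lebesgue M"
    unfolding steiner_eq_rotated[OF u, of M] M'_def[symmetric]
    using lebesgue_rotate[OF u s] e by (simp_all only:)
qed

text \<open>
  The polar moment of inertia about the origin.
\<close>

definition energy :: "complex set \<Rightarrow> ennreal" where
  "energy M = (\<integral>\<^sup>+z. indicator M z * ennreal ((norm z)\<^sup>2) \<partial>lebesgue)"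

lemma energy_rotate:
  fixes c :: complex
  assumes c: "norm c = 1" and M: "M \<in> sets lebesgue"
  shows "energy ((*) c ` M) = energy M"
proof -
  have c0: "c \<noteq> 0" using c by auto
  have "(\<lambda>z. ennreal ((norm z)\<^sup>2)) \<in> borel_measurable (lebesgue :: complex measure)"
    by (rule measurable_completion) simp
  then have m: "(\<lambda>z. indicator ((*) c ` M) z * ennreal ((norm z)\<^sup>2)) \<in> borel_measurable lebesgue"
    using lebesgue_rotate(1)[OF c M] by (intro borel_measurable_times_ennreal) auto
  have "indicator ((*) c ` M) (c * z) = (indicator M z :: ennreal)" for z
    using c0 by (auto simp: indicator_def)
  then show ?thesis
    using nn_integral_rotate[OF c m] c by (simp add: energy_def norm_mult)
qed

text \<open>
  On the line at height \<open>s\<close> the symmetral is the interval \<open>[-g, g]\<close>.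
  Points leaving it satisfy \<open>\<bar>t\<bar> \<ge> g\<close> and points entering it
  satisfy \<open>\<bar>t\<bar> \<le> g\<close>, in equal measure, so comparing
  \<open>t\<^sup>2\<close> with the constant \<open>g\<^sup>2\<close> of the line shows that
  the energy drops, and by at least \<open>\<eta>\<^sup>2\<close> per unit measure of leaving
  points with \<open>\<bar>t\<bar> \<ge> g + \<eta>\<close>. The points of the strip
  \<open>\<bar>s\<bar> \<le> R\<close> with \<open>g \<le> \<bar>t\<bar> < g + \<eta>\<close>
  fill a set of measure at most \<open>4 R \<eta>\<close>.
\<close>

lemma energy_centred:
  assumes C[measurable]: "C \<in> sets borel" and sub: "C \<subseteq> cball 0 R" and R: "R \<ge> 0" and \<eta>: "\<eta> > 0"
  shows "energy (centred C) + ennreal (\<eta>\<^sup>2) * emeasure lborel (C - centred C)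
       \<le> energy C + ennreal (\<eta>\<^sup>2 * (4 * R * \<eta>))"
proof -
  let ?B = "centred C"
  define g where "g s = enn2real (section_measure C s) / 2" for s
  have g_meas[measurable]: "g \<in> borel_measurable borel" unfolding g_def by measurable
  have lt: "section_measure C s \<le> ennreal (2 * R)" for s
  proof -
    have "section_measure C s \<le> emeasure lborel {-R..R}"
      unfolding section_measure_def
    proof (rule emeasure_mono)
      show "{t. Complex t s \<in> C} \<subseteq> {-R..R}"
      proof clarify
        fix t assume "Complex t s \<in> C"
        then have "norm (Complex t s) \<le> R" using sub by auto
        then have "\<bar>t\<bar> \<le> R" using abs_Re_le_cmod[of "Complex t s"] by simp
        then show "t \<in> {-R..R}" by auto
      qed
    qed auto
    then show ?thesis using R by simp
  qed
  have fin: "section_measure C s = ennreal (2 * g s)" for s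
  proof -
    have "section_measure C s < top" using lt[of s] by (rule le_less_trans) simp
    then show ?thesis by (simp add: g_def)
  qed
  have g0: "g s \<ge> 0" for s by (simp add: g_def)
  have gR: "g s \<le> R" for s using lt[of s] R unfolding fin by simp
  \<comment> \<open>Contains the points of \<open>C - ?B\<close> whose removal gains less than
    \<open>\<eta>\<^sup>2\<close> per unit measure.\<close>
  define E where "E = {z. \<bar>Im z\<bar> \<le> R \<and> g (Im z) \<le> \<bar>Re z\<bar> \<and> \<bar>Re z\<bar> < g (Im z) + \<eta>}"
  have E[measurable]: "E \<in> sets borel" unfolding E_def by measurable
  have B: "z \<in> ?B \<longleftrightarrow> 0 < g (Im z) \<and> \<bar>Re z\<bar> \<le> g (Im z)" for z
    by (simp add: centred_def fin ennreal_le_iff g0)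
  let ?h = "\<lambda>s. ennreal ((g s)\<^sup>2 + s\<^sup>2)"
  let ?n = "\<lambda>z::complex. ennreal ((norm z)\<^sup>2)"
  have nrm: "(norm z)\<^sup>2 = (Re z)\<^sup>2 + (Im z)\<^sup>2" for z by (simp add: cmod_def)
  \<comment> \<open>The weight of a line on the left is carried by \<open>C\<close> and on the
    right by the symmetral, so that all terms are nonnegative; the two weights have the same
    integral and cancel after integration.\<close>
  have pt: "indicator ?B z * ?n z + ennreal (\<eta>\<^sup>2) * indicator (C - ?B) z + indicator C z * ?h (Im z)
      \<le> indicator C z * ?n z + ennreal (\<eta>\<^sup>2) * indicator E z + indicator ?B z * ?h (Im z)" for z
  proof -
    have gle: "(g (Im z))\<^sup>2 \<le> (Re z)\<^sup>2" if "g (Im z) \<le> \<bar>Re z\<bar>"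
      using power_mono[OF that g0, of 2] by simp
    consider "z \<in> ?B" "z \<in> C" | "z \<in> ?B" "z \<notin> C" | "z \<notin> ?B" "z \<in> C" | "z \<notin> ?B" "z \<notin> C" by blast
    then show ?thesis
    proof cases
      case 1 then show ?thesis by (simp add: add_right_mono)
    next
      case 2
      then have "(Re z)\<^sup>2 \<le> (g (Im z))\<^sup>2" using power_mono[of "\<bar>Re z\<bar>" "g (Im z)" 2] by (simp add: B)
      then have "?n z \<le> ?h (Im z)" by (intro ennreal_leI) (simp add: nrm)
      then show ?thesis using 2 by (simp add: add_increasing)
    next
      case 3
      then have "norm z \<le> R" using sub by auto
      then have im: "\<bar>Im z\<bar> \<le> R" using abs_Im_le_cmod[of z] by linarith
      have ge: "g (Im z) \<le> \<bar>Re z\<bar>" using 3 g0[of "Im z"] by (auto simp: B)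
      have "ennreal (\<eta>\<^sup>2) + ?h (Im z) \<le> ?n z + ennreal (\<eta>\<^sup>2) * indicator E z"
      proof (cases "z \<in> E")
        case True
        have "?h (Im z) \<le> ?n z" using gle[OF ge] by (intro ennreal_leI) (simp add: nrm)
        then show ?thesis using True by (simp add: add.commute add_left_mono)
      next
        case False
        then have "g (Im z) + \<eta> \<le> \<bar>Re z\<bar>" using im ge by (auto simp: E_def)
        then have "(g (Im z) + \<eta>)\<^sup>2 \<le> (Re z)\<^sup>2"
          using power_mono[of "g (Im z) + \<eta>" "\<bar>Re z\<bar>" 2] g0[of "Im z"] \<eta> by simp
        moreover have "(g (Im z))\<^sup>2 + \<eta>\<^sup>2 \<le> (g (Im z) + \<eta>)\<^sup>2"
          using g0[of "Im z"] \<eta> by (simp add: power2_sum)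
        ultimately have "\<eta>\<^sup>2 + ((g (Im z))\<^sup>2 + (Im z)\<^sup>2) \<le> (norm z)\<^sup>2" by (simp add: nrm)
        then show ?thesis using False by (simp add: ennreal_plus[symmetric] ennreal_leI del: ennreal_plus)
      qed
      then show ?thesis using 3 by simp
    qed simp
  qed
  have mn[measurable]: "?n \<in> borel_measurable borel" by simp
  have G: "(\<integral>\<^sup>+z. indicator ?B z * ?h (Im z) \<partial>lborel) = (\<integral>\<^sup>+z. indicator C z * ?h (Im z) \<partial>lborel)" (is "_ = ?G")
    by (rule nn_integral_centred) measurable
  have Gfin: "?G < \<infinity>"
  proof -
    have "?G \<le> (\<integral>\<^sup>+z. ennreal (2 * R\<^sup>2) * indicator (cball 0 R) z \<partial>(lborel :: complex measure))"
    proof (rule nn_integral_mono)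
      fix z :: complex
      show "indicator C z * ?h (Im z) \<le> ennreal (2 * R\<^sup>2) * indicator (cball 0 R) z"
      proof (cases "z \<in> C")
        case True
        then have z: "norm z \<le> R" using sub by auto
        then have "\<bar>Im z\<bar> \<le> R" using abs_Im_le_cmod[of z] by linarith
        then have "(Im z)\<^sup>2 \<le> R\<^sup>2" using power_mono[of "\<bar>Im z\<bar>" R 2] by simp
        moreover have "(g (Im z))\<^sup>2 \<le> R\<^sup>2" using gR g0 by (intro power_mono) auto
        ultimately have "?h (Im z) \<le> ennreal (2 * R\<^sup>2)" by (intro ennreal_leI) simp
        then show ?thesis using True z by simp
      qed simp
    qed
    also have "\<dots> = ennreal (2 * R\<^sup>2) * emeasure lborel (cball (0::complex) R)"
      by (simp add: nn_integral_cmult_indicator)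
    also have "\<dots> < \<infinity>" using emeasure_bounded_finite[OF bounded_cball[of "0::complex" R]] by (simp add: ennreal_mult_less_top)
    finally show ?thesis .
  qed
  have Em: "emeasure lborel E \<le> ennreal (4 * R * \<eta>)"
  proof -
    have "section_measure E s \<le> ennreal (2 * \<eta>) * indicator {-R..R} s" for s
    proof (cases "\<bar>s\<bar> \<le> R")
      case True
      have "section_measure E s \<le> emeasure lborel ({g s..g s + \<eta>} \<union> {- (g s + \<eta>)..- g s})"
        unfolding section_measure_def by (rule emeasure_mono) (auto simp: E_def)
      also have "\<dots> \<le> emeasure lborel {g s..g s + \<eta>} + emeasure lborel {- (g s + \<eta>)..- g s}"
        by (rule emeasure_subadditive) auto
      also have "\<dots> = ennreal (2 * \<eta>)" using \<eta> by (simp add: ennreal_plus[symmetric] del: ennreal_plus)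
      finally show ?thesis using True by (simp add: abs_le_iff)
    next
      case False
      then have "{t. Complex t s \<in> E} = {}" by (auto simp: E_def)
      then show ?thesis by (simp add: section_measure_def)
    qed
    then have "emeasure lborel E \<le> (\<integral>\<^sup>+s. ennreal (2 * \<eta>) * indicator {-R..R} s \<partial>lborel)"
      unfolding emeasure_complex_sections[OF E] by (intro nn_integral_mono)
    also have "\<dots> = ennreal (4 * R * \<eta>)"
      using R \<eta> by (simp add: nn_integral_cmult_indicator ennreal_mult[symmetric])
    finally show ?thesis .
  qed
  have cancel: "a \<le> b" if "a + c \<le> b + c" "c < \<infinity>" for a b c :: ennreal
    using that ennreal_add_left_cancel_le[of c a b] by (auto simp: add.commute)
  have "(\<integral>\<^sup>+z. indicator ?B z * ?n z + ennreal (\<eta>\<^sup>2) * indicator (C - ?B) z + indicator C z * ?h (Im z) \<partial>lborel)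
      \<le> (\<integral>\<^sup>+z. indicator C z * ?n z + ennreal (\<eta>\<^sup>2) * indicator E z + indicator ?B z * ?h (Im z) \<partial>lborel)"
    by (rule nn_integral_mono) (rule pt)
  then have "energy ?B + ennreal (\<eta>\<^sup>2) * emeasure lborel (C - ?B) + ?G
      \<le> energy C + ennreal (\<eta>\<^sup>2) * emeasure lborel E + ?G"
    by (simp add: nn_integral_add nn_integral_cmult_indicator energy_def nn_integral_completion G del: ennreal_plus)
  then have "energy ?B + ennreal (\<eta>\<^sup>2) * emeasure lborel (C - ?B)
      \<le> energy C + ennreal (\<eta>\<^sup>2) * emeasure lborel E"
    by (rule cancel) (rule Gfin)
  also have "\<dots> \<le> energy C + ennreal (\<eta>\<^sup>2) * ennreal (4 * R * \<eta>)"
    by (intro add_left_mono mult_left_mono Em) simp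
  also have "\<dots> = energy C + ennreal (\<eta>\<^sup>2 * (4 * R * \<eta>))"
    using R \<eta> by (simp add: ennreal_mult)
  finally show ?thesis .
qed

lemma energy_cong_AE:
  "AE z in lebesgue. z \<in> A \<longleftrightarrow> z \<in> B \<Longrightarrow> energy A = energy B"
  unfolding energy_def by (rule nn_integral_cong_AE) (auto simp: indicator_def elim: eventually_mono)

lemma energy_steiner:
  assumes u: "norm u = 1" and M: "M \<in> sets lebesgue" and sub: "M \<subseteq> cball 0 R"
    and R: "R \<ge> 0" and \<eta>: "\<eta> > 0"
  shows "energy (steiner u M) + ennreal (\<eta>\<^sup>2) * emeasure lebesgue (M - steiner u M)
       \<le> energy M + ennreal (\<eta>\<^sup>2 * (4 * R * \<eta>))"
proof -
  define M' where "M' = (*) (cnj u) ` M"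
  have u': "norm (cnj u) = 1" using u by simp
  have M': "M' \<in> sets lebesgue" "energy M' = energy M"
    unfolding M'_def by (rule lebesgue_rotate[OF u' M], rule energy_rotate[OF u' M])
  have sub': "M' \<subseteq> cball 0 R" using sub u by (auto simp: M'_def norm_mult)
  obtain C where C[measurable]: "C \<in> sets borel" and CM: "C \<subseteq> M'" and AE: "AE z in lebesgue. z \<in> M' \<longleftrightarrow> z \<in> C"
    "AE z in lebesgue. z \<in> steiner 1 M' \<longleftrightarrow> z \<in> centred C"
    using steiner_1_AE[OF M'(1)] by metis
  have st: "steiner 1 M' \<in> sets lebesgue" using steiner_lebesgue(1)[OF _ M'(1), of 1] by simp
  have su: "steiner u M = (*) u ` steiner 1 M'" unfolding M'_def by (rule steiner_eq_rotated[OF u])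
  have uM: "M = (*) u ` M'" unfolding M'_def rotate_rotate_back[OF u] ..
  have u0: "u \<noteq> 0" using u by auto
  have "M - steiner u M = (*) u ` (M' - steiner 1 M')"
    unfolding uM su[unfolded uM] using u0 by (subst image_set_diff) (auto intro: injI)
  then have d: "emeasure lebesgue (M - steiner u M) = emeasure lebesgue (M' - steiner 1 M')"
    using lebesgue_rotate(2)[OF u, of "M' - steiner 1 M'"] M' st by (metis sets.Diff)
  also have "\<dots> = emeasure lebesgue (C - centred C)"
    by (rule emeasure_eq_AE) (use AE st M' in auto)
  finally have d: "emeasure lebesgue (M - steiner u M) = emeasure lborel (C - centred C)" by simp
  have e: "energy (steiner u M) = energy (centred C)"
    unfolding su energy_rotate[OF u st] by (rule energy_cong_AE[OF AE(2)])
  have e': "energy M = energy C"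
    unfolding M'(2)[symmetric] by (rule energy_cong_AE[OF AE(1)])
  show ?thesis
    unfolding d e e' by (rule energy_centred[OF C _ R \<eta>]) (use CM sub' in auto)
qed

section \<open>The distance and the stability of balls\<close>

lemma d1_nonneg: "d1 A B \<ge> 0" by (simp add: d1_def)

lemma d1_commute: "d1 A B = d1 B A" by (simp add: d1_def Un_commute)

lemma d1_triangle:
  assumes "A \<in> lmeasurable" "B \<in> lmeasurable" "C \<in> lmeasurable"
  shows "d1 A C \<le> d1 A B + d1 B C"
proof -
  have "d1 A C \<le> measure lebesgue (sym_diff A B \<union> sym_diff B C)"
    unfolding d1_def using assms by (intro measure_mono_fmeasurable) auto
  also have "\<dots> \<le> d1 A B + d1 B C"
    unfolding d1_def using assms by (intro measure_Un_le) auto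
  finally show ?thesis .
qed

lemma d1_eq_sum:
  assumes "A \<in> lmeasurable" "B \<in> lmeasurable"
  shows "d1 A B = measure lebesgue (A - B) + measure lebesgue (B - A)"
  unfolding d1_def using assms by (intro measure_Un_AE) (auto intro: fmeasurable.Diff)

lemma measure_Diff_Int:
  assumes "A \<in> lmeasurable" "B \<in> lmeasurable"
  shows "measure lebesgue (A - B) = measure lebesgue A - measure lebesgue (A \<inter> B)"
proof -
  have "A - B = A - (A \<inter> B)" by auto
  then show ?thesis using assms by (simp add: measurable_measure_Diff fmeasurable.Int fmeasurableD)
qed

lemma d1_equal_measure:
  assumes "A \<in> lmeasurable" "B \<in> lmeasurable" "measure lebesgue A = measure lebesgue B"
  shows "measure lebesgue (B - A) = measure lebesgue (A - B)" "d1 A B = 2 * measure lebesgue (A - B)"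
proof -
  show "measure lebesgue (B - A) = measure lebesgue (A - B)"
    using assms by (simp add: measure_Diff_Int Int_commute)
  then show "d1 A B = 2 * measure lebesgue (A - B)" using assms by (simp add: d1_eq_sum)
qed

lemma d1_orthogonal_image:
  assumes f: "orthogonal_transformation f" and A: "A \<in> lmeasurable" and B: "B \<in> lmeasurable"
  shows "d1 (f ` A) (f ` B) = d1 A B"
proof -
  have "sym_diff (f ` A) (f ` B) = f ` sym_diff A B"
    using orthogonal_transformation_inj[OF f] by (simp add: image_Un image_set_diff)
  then show ?thesis
    unfolding d1_def using lmeasurable_orthogonal_image(2)[OF f, of "sym_diff A B"] A B
    by (simp add: fmeasurable.Un fmeasurable.Diff)
qed

lemma steiner_lmeasurable:
  assumes "norm u = 1" "M \<in> lmeasurable"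
  shows "steiner u M \<in> lmeasurable" "measure lebesgue (steiner u M) = measure lebesgue M"
  using steiner_lebesgue[OF assms(1), of M] assms(2) by (auto simp: fmeasurable_def measure_def)

text \<open>
  Only monotonicity and preservation of measure are used: the symmetral of \<open>A \<inter>
  B\<close> lies in both symmetrals, so their intersection is at least as large as \<open>A
  \<inter> B\<close>.
\<close>

lemma d1_steiner_le:
  assumes u: "norm u = 1" and A: "A \<in> lmeasurable" and B: "B \<in> lmeasurable"
  shows "d1 (steiner u A) (steiner u B) \<le> d1 A B"
proof -
  have half: "measure lebesgue (steiner u A - steiner u B) \<le> measure lebesgue (A - B)"
    if A: "A \<in> lmeasurable" and B: "B \<in> lmeasurable" for A B
  proof -
    note st = steiner_lmeasurable[OF u]
    have AB: "A \<inter> B \<in> lmeasurable" using A B by auto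
    have "measure lebesgue (A \<inter> B) = measure lebesgue (steiner u (A \<inter> B))" by (rule st(2)[OF AB, symmetric])
    also have "\<dots> \<le> measure lebesgue (steiner u A \<inter> steiner u B)"
      using steiner_mono[OF u, of "A \<inter> B" A] steiner_mono[OF u, of "A \<inter> B" B] A B st AB
      by (intro measure_mono_fmeasurable) (auto intro: fmeasurable.Int fmeasurableD)
    finally show ?thesis using A B st by (simp add: measure_Diff_Int)
  qed
  show ?thesis
    using half[OF A B] half[OF B A] A B steiner_lmeasurable[OF u] by (simp add: d1_eq_sum)
qed

lemma borel_inner_kernel:
  fixes S :: "'a::euclidean_space set"
  assumes "S \<in> sets lebesgue"
  obtains C where "C \<in> sets borel" "C \<subseteq> S" "emeasure lborel C = emeasure lebesgue S"
proof
  show "main_part lborel S \<in> sets borel" using main_part_sets[OF assms] by simp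
  show "main_part lborel S \<subseteq> S" using main_part_null_part_Un[OF assms] by auto
  show "emeasure lborel (main_part lborel S) = emeasure lebesgue S" using assms by simp
qed

lemma emeasure_times_eq_shifts:
  fixes P Q :: "'a::euclidean_space set"
  assumes [measurable]: "P \<in> sets borel" "Q \<in> sets borel"
  shows "emeasure lborel P * emeasure lborel Q = (\<integral>\<^sup>+h. emeasure lborel {x \<in> P. x + h \<in> Q} \<partial>lborel)"
proof -
  have "emeasure lborel P * emeasure lborel Q = (\<integral>\<^sup>+x. indicator P x * emeasure lborel Q \<partial>lborel)"
    by (simp add: nn_integral_multc)
  also have "\<dots> = (\<integral>\<^sup>+x. (\<integral>\<^sup>+h. indicator P x * indicator Q (x + h) \<partial>lborel) \<partial>lborel)"
  proof (rule nn_integral_cong)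
    fix x :: 'a
    have "emeasure lborel Q = (\<integral>\<^sup>+y. indicator Q y \<partial>distr lborel borel ((+) x))"
      by (simp add: lborel_distr_plus)
    also have "\<dots> = (\<integral>\<^sup>+h. indicator Q (x + h) \<partial>lborel)"
      by (rule nn_integral_distr) auto
    finally show "indicator P x * emeasure lborel Q = (\<integral>\<^sup>+h. indicator P x * indicator Q (x + h) \<partial>lborel)"
      by (simp add: nn_integral_cmult)
  qed
  also have "\<dots> = (\<integral>\<^sup>+h. (\<integral>\<^sup>+x. indicator P x * indicator Q (x + h) \<partial>lborel) \<partial>lborel)"
    by (rule lborel_pair.Fubini'[symmetric]) measurable
  also have "\<dots> = (\<integral>\<^sup>+h. emeasure lborel {x \<in> P. x + h \<in> Q} \<partial>lborel)"
  proof (rule nn_integral_cong)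
    fix h :: 'a
    have m: "{x \<in> P. x + h \<in> Q} \<in> sets borel"
    proof -
      have "(\<lambda>x. x + h) -` Q \<inter> space borel \<in> sets borel" by (rule measurable_sets[of _ borel borel]) auto
      then have "P \<inter> (\<lambda>x. x + h) -` Q \<in> sets borel" by auto
      moreover have "P \<inter> (\<lambda>x. x + h) -` Q = {x \<in> P. x + h \<in> Q}" by auto
      ultimately show ?thesis by simp
    qed
    have "(\<lambda>x. indicator P x * indicator Q (x + h) :: ennreal) = indicator {x \<in> P. x + h \<in> Q}"
      by (auto simp: indicator_def fun_eq_iff)
    then show "(\<integral>\<^sup>+x. indicator P x * indicator Q (x + h) \<partial>lborel) = emeasure lborel {x \<in> P. x + h \<in> Q}"
      using m by simp
  qed
  finally show ?thesis .
qed

text \<open>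
  Here \<open>sgn h\<close> is the direction of \<open>h\<close>. A symmetral containing
  \<open>x\<close> contains the point \<open>x + h\<close>, which is no farther from the
  origin; so if \<open>L\<close> separates the two points, it differs from its symmetral at
  one of them.
\<close>

lemma steiner_pair_exclusion:
  assumes h: "h \<noteq> 0" and x: "x \<in> L" "x + h \<notin> L" and le: "norm (x + h) \<le> norm x"
  shows "x \<in> L - steiner (sgn h) L \<or> x + h \<in> steiner (sgn h) L - L"
proof -
  have u: "norm (sgn h) = 1" using h by (simp add: norm_sgn)
  have hh: "h = of_real (norm h) * sgn h" using h by (simp add: sgn_div_norm scaleR_conv_of_real)
  show ?thesis
  proof (cases "x \<in> steiner (sgn h) L")
    case True
    then have "x + h \<in> steiner (sgn h) L"
      using steiner_slide[OF u True, of "norm h"] hh le by simp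
    then show ?thesis using x by simp
  qed (use x in simp)
qed

text \<open>
  The product of the measures of \<open>L\<close> minus the ball and of the ball minus
  \<open>L\<close>, which are equal, is an integral over the difference \<open>h\<close> of
  the two points. For fixed \<open>h\<close> the pairs are confined, by
  \<open>steiner_pair_exclusion\<close>, to the symmetric difference of \<open>L\<close> and
  one of its symmetrals, up to a translation of one half.
\<close>

lemma ball_deficit_le:
  fixes L :: "complex set"
  assumes L: "L \<in> lmeasurable" and sub: "L \<subseteq> cball 0 R" and r: "r \<le> R"
    and eq: "measure lebesgue L = measure lebesgue (cball (0::complex) r)"
    and e: "\<And>v. norm v = 1 \<Longrightarrow> d1 L (steiner v L) \<le> e"
  shows "(measure lebesgue (L - cball 0 r))\<^sup>2 \<le> e * measure lebesgue (cball (0::complex) (2 * R))"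
proof -
  define B where "B = cball (0::complex) r"
  have B: "B \<in> lmeasurable" by (simp add: B_def)
  have e0: "e \<ge> 0" using e[of 1] d1_nonneg[of L "steiner 1 L"] by simp
  define m where "m = measure lebesgue (L - B)"
  have lm: "L - B \<in> lmeasurable" "B - L \<in> lmeasurable" using L B by auto
  have m: "emeasure lebesgue (L - B) = ennreal m" "emeasure lebesgue (B - L) = ennreal m"
    using d1_equal_measure(1)[OF L B] eq lm unfolding m_def B_def by (metis emeasure_eq_measure2)+
  obtain P where P: "P \<in> sets borel" "P \<subseteq> L - B" "emeasure lborel P = ennreal m"
    using borel_inner_kernel[of "L - B"] lm m by (metis fmeasurableD)
  obtain Q where Q: "Q \<in> sets borel" "Q \<subseteq> B - L" "emeasure lborel Q = ennreal m"
    using borel_inner_kernel[of "B - L"] lm m by (metis fmeasurableD)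
  note [measurable] = P(1) Q(1)
  have bound: "emeasure lborel {x \<in> P. x + h \<in> Q} \<le> ennreal e * indicator (cball 0 (2 * R)) h" for h
  proof (cases "{x \<in> P. x + h \<in> Q} = {}")
    case True show ?thesis unfolding True by simp
  next
    case False
    then obtain x where x: "x \<in> P" "x + h \<in> Q" by auto
    have "norm x \<le> R" "norm (x + h) \<le> R" using x P(2) Q(2) sub r by (auto simp: B_def)
    then have hR: "norm h \<le> 2 * R" using norm_triangle_ineq4[of "x + h" x] by simp
    have h0: "h \<noteq> 0" using x P(2) Q(2) by auto
    define v where "v = sgn h"
    have v: "norm v = 1" using h0 by (simp add: v_def norm_sgn)
    define S where "S = steiner v L"
    have S: "S \<in> lmeasurable" unfolding S_def by (rule steiner_lmeasurable[OF v L])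
    have sb: "{x \<in> P. x + h \<in> Q} \<subseteq> (L - S) \<union> (\<lambda>x. x + - h) ` (S - L)"
    proof clarify
      fix y assume y: "y \<in> P" "y + h \<in> Q" "y \<notin> (\<lambda>x. x + - h) ` (S - L)"
      have "norm (y + h) \<le> norm y" "y \<in> L" "y + h \<notin> L"
        using set_mp[OF P(2) y(1)] set_mp[OF Q(2) y(2)] by (auto simp: B_def)
      then have "y \<in> L - S \<or> y + h \<in> S - L"
        using steiner_pair_exclusion[OF h0] unfolding S_def v_def by blast
      moreover have "y + h \<notin> S - L" using y(3) image_eqI[of y "\<lambda>x. x + - h" "y + h" "S - L"] by auto
      ultimately show "y \<in> L - S" by blast
    qed
    have SL: "S - L \<in> sets lebesgue" "L - S \<in> sets lebesgue" using S L by auto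
    have "emeasure lborel {x \<in> P. x + h \<in> Q} \<le> emeasure lebesgue {x \<in> P. x + h \<in> Q}"
    proof -
      have "{x \<in> P. x + h \<in> Q} \<in> sets lborel" by measurable
      then show ?thesis by simp
    qed
    also have "\<dots> \<le> emeasure lebesgue ((L - S) \<union> (\<lambda>x. x + - h) ` (S - L))"
      using emeasure_lebesgue_shift(1)[OF SL(1), of "-h"] SL by (intro emeasure_mono[OF sb] sets.Un)
    also have "\<dots> \<le> emeasure lebesgue (L - S) + emeasure lebesgue ((\<lambda>x. x + - h) ` (S - L))"
      using emeasure_lebesgue_shift(1)[OF SL(1), of "-h"] SL by (intro emeasure_subadditive)
    also have "\<dots> = emeasure lebesgue (L - S) + emeasure lebesgue (S - L)"
      unfolding emeasure_lebesgue_shift(2)[OF SL(1)] ..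
    also have "\<dots> = ennreal (d1 L S)"
    proof -
      have "L - S \<in> lmeasurable" "S - L \<in> lmeasurable" using S L by auto
      then show ?thesis
        unfolding d1_eq_sum[OF L S] by (simp only: emeasure_eq_measure2 ennreal_plus measure_nonneg)
    qed
    also have "\<dots> \<le> ennreal e" unfolding S_def by (intro ennreal_leI e v)
    finally show ?thesis using hR by simp
  qed
  have "ennreal (m * m) = emeasure lborel P * emeasure lborel Q"
    by (simp add: P Q m_def ennreal_mult)
  also have "\<dots> = (\<integral>\<^sup>+h. emeasure lborel {x \<in> P. x + h \<in> Q} \<partial>lborel)"
    by (rule emeasure_times_eq_shifts) fact+
  also have "\<dots> \<le> (\<integral>\<^sup>+h. ennreal e * indicator (cball 0 (2 * R)) h \<partial>(lborel :: complex measure))"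
    by (intro nn_integral_mono bound)
  also have "\<dots> = ennreal e * emeasure lborel (cball (0::complex) (2 * R))"
    by (simp add: nn_integral_cmult_indicator)
  also have "\<dots> = ennreal e * emeasure lebesgue (cball (0::complex) (2 * R))" by simp
  also have "\<dots> = ennreal (e * measure lebesgue (cball (0::complex) (2 * R)))"
    using e0 emeasure_eq_measure2[of "cball (0::complex) (2 * R)" lebesgue]
    by (simp only: lmeasurable_cball ennreal_mult measure_nonneg)
  finally have "m * m \<le> e * measure lebesgue (cball (0::complex) (2 * R))"
    using e0 by (subst (asm) ennreal_le_iff) auto
  then show ?thesis by (simp add: power2_eq_square m_def B_def)
qed

section \<open>The Kakutani-Fibonacci sequence and irrational rotations\<close>

lemma kf_gamma_irrational: "kf_gamma \<notin> \<rat>"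
proof
  assume "kf_gamma \<in> \<rat>"
  then have "2 * kf_gamma + 1 \<in> \<rat>" by (intro Rats_add Rats_mult) auto
  moreover have "2 * kf_gamma + 1 = sqrt 5" unfolding kf_gamma_def by (simp add: field_simps)
  ultimately have "sqrt 5 \<in> \<rat>" by (simp only:)
  then obtain m n :: nat where n: "n \<noteq> 0" and mn: "\<bar>sqrt 5\<bar> = real m / real n" and cop: "coprime m n"
    by (rule Rats_abs_nat_div_natE)
  then have "real m = sqrt 5 * real n" by (simp add: field_simps)
  then have "(real m)\<^sup>2 = 5 * (real n)\<^sup>2" by (simp add: power_mult_distrib)
  then have eq: "m\<^sup>2 = 5 * n\<^sup>2" by (metis of_nat_eq_iff of_nat_mult of_nat_numeral of_nat_power)
  have five: "5 dvd k" if "5 dvd k\<^sup>2" for k :: nat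
    using that prime_dvd_power[of 5 k 2] by simp
  have "5 dvd m" by (rule five) (simp add: eq)
  then obtain k where k: "m = 5 * k" ..
  have "(5 * k)\<^sup>2 = 5 * n\<^sup>2" using eq unfolding k .
  then have "n\<^sup>2 = 5 * k\<^sup>2" by (simp add: power_mult_distrib)
  then have "5 dvd n" using five[of n] by simp
  then show False using coprime_common_divisor_nat[OF cop \<open>5 dvd m\<close>] by simp
qed

lemma bit_power_of_two: "bit (2 ^ k :: nat) j \<longleftrightarrow> j = k"
  by (auto simp: bit_exp_iff)

lemma bit_Suc_power_of_two:
  assumes "k > 0" shows "bit (Suc (2 ^ k)) j \<longleftrightarrow> j = 0 \<or> j = k"
proof -
  obtain k' where k: "k = Suc k'" using assms by (cases k) auto
  show ?thesis
  proof (cases j)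
    case (Suc i)
    have "bit (Suc (2 ^ k)) j = bit (2 ^ k' :: nat) i" by (simp add: k Suc bit_Suc)
    then show ?thesis by (simp add: bit_power_of_two Suc k)
  qed (simp add: bit_0 k)
qed

lemma radical_inverse_eq_sum:
  assumes "2 ^ k \<le> n" "n < 2 ^ Suc k"
  shows "radical_inverse n = (\<Sum>j | j \<le> k \<and> bit n j. kf_gamma ^ (j + 1))"
proof -
  have "\<lfloor>log 2 (real n)\<rfloor> = int k"
    using floor_log_nat_eq_if[of 2 k n] assms by simp
  then have "radical_inverse n = (\<Sum>j\<in>{0..k}. if bit n j then kf_gamma ^ (j + 1) else 0)"
    unfolding radical_inverse_def by (intro sum.cong) auto
  also have "\<dots> = (\<Sum>j | j \<le> k \<and> bit n j. kf_gamma ^ (j + 1))"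
    by (subst sum.inter_filter[symmetric]) (auto intro!: sum.cong)
  finally show ?thesis .
qed

text \<open>
  The indices \<open>2 ^ k\<close> and \<open>2 ^ k + 1\<close> with \<open>k \<ge> 2\<close>
  are consecutive admissible numbers, and passing from the first to the second only sets the
  digit of weight \<open>\<gamma>\<close>.
\<close>

lemma kakutani_fibonacci_step:
  "\<exists>n\<ge>N. kakutani_fibonacci (Suc (Suc n)) = kakutani_fibonacci (Suc n) + kf_gamma"
proof -
  define e where "e = enumerate N_gamma"
  obtain k where k: "k \<ge> 2" and big: "e N < 2 ^ k"
  proof (rule that[of "e N + 2"])
    have "e N < 2 ^ e N" by (rule less_exp)
    also have "\<dots> \<le> 2 ^ (e N + 2)" by simp
    finally show "e N < 2 ^ (e N + 2)" .
  qed simp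
  have "2 ^ k \<in> N_gamma" by (auto simp: N_gamma_def bit_power_of_two)
  then obtain n where n: "e n = 2 ^ k" unfolding e_def using enumerate_Ex[OF infinite_N_gamma] by blast
  have "N \<le> n"
    using big n enumerate_mono_iff[OF infinite_N_gamma, of N n] by (simp add: e_def)
  have "Suc (2 ^ k) \<in> N_gamma"
    using bit_Suc_power_of_two[of k] k by (auto simp: N_gamma_def)
  then have "(LEAST s. s \<in> N_gamma \<and> 2 ^ k < s) = Suc (2 ^ k)" by (intro Least_equality) auto
  then have n': "e (Suc n) = Suc (2 ^ k)"
    unfolding e_def using n enumerate_Suc''[OF infinite_N_gamma, of n] by (simp add: e_def)
  have k1: "(2 ^ k :: nat) > 1" by (rule one_less_power) (use k in simp_all)
  have "{j. j \<le> k \<and> bit (2 ^ k :: nat) j} = {k}" by (auto simp: bit_power_of_two)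
  then have r: "radical_inverse (2 ^ k) = kf_gamma ^ (k + 1)"
    using radical_inverse_eq_sum[of k "2 ^ k"] by simp
  have "{j. j \<le> k \<and> bit (Suc (2 ^ k)) j} = {0, k}" using k by (auto simp: bit_Suc_power_of_two)
  moreover have "k \<noteq> 0" using k by simp
  ultimately have "radical_inverse (Suc (2 ^ k)) = kf_gamma ^ (k + 1) + kf_gamma"
    using radical_inverse_eq_sum[of k "Suc (2 ^ k)"] k1 by simp
  then have "kakutani_fibonacci (Suc (Suc n)) = kakutani_fibonacci (Suc n) + kf_gamma"
    using n n' r by (simp add: kakutani_fibonacci_def e_def)
  then show ?thesis using \<open>N \<le> n\<close> by blast
qed

lemma irrational_rotation_dense:
  assumes g: "g \<notin> \<rat>" and a: "norm a = 1" and \<eta>: "\<eta> > 0"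
  shows "\<exists>k. dist a (cis (2 * pi * g) ^ k) < \<eta>"
proof -
  define al where "al = Arg a / (2 * pi)"
  have a_eq: "a = cis (2 * pi * al)"
  proof -
    have "a \<noteq> 0" using a by auto
    moreover have "sgn a = a" using a by (simp add: sgn_div_norm)
    ultimately show ?thesis using cis_Arg[of a] by (simp add: al_def)
  qed
  have "isCont (\<lambda>t. cis (2 * pi * t)) al" unfolding cis_conv_exp by (intro continuous_intros)
  then obtain d where d: "d > 0" "\<And>t. dist t al < d \<Longrightarrow> dist (cis (2 * pi * t)) (cis (2 * pi * al)) < \<eta>"
    unfolding continuous_at_eps_delta using \<eta> by metis
  obtain h k :: int where hk: "k > 0" "\<bar>of_int k * g - of_int h - al\<bar> < d"
    using sequence_of_fractional_parts_is_dense[OF g d(1)] by metis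
  have "2 * pi * (of_int k * g - of_int h) = real (nat k) * (2 * pi * g) - 2 * pi * of_int h"
    using hk(1) by (simp add: algebra_simps)
  then have "cis (2 * pi * (of_int k * g - of_int h)) = cis (2 * pi * g) ^ nat k / cis (2 * pi * of_int h)"
    unfolding Complex.DeMoivre cis_divide by (simp only:)
  also have "cis (2 * pi * of_int h) = 1" by simp
  finally have "cis (2 * pi * (of_int k * g - of_int h)) = cis (2 * pi * g) ^ nat k" by simp
  moreover have "dist (cis (2 * pi * (of_int k * g - of_int h))) a < \<eta>"
    unfolding a_eq by (rule d(2)) (use hk in \<open>simp add: dist_real_def\<close>)
  ultimately show ?thesis by (metis dist_commute)
qed

lemma powers_uniformly_dense:
  assumes dense: "\<And>a \<eta>. norm a = 1 \<Longrightarrow> \<eta> > 0 \<Longrightarrow> \<exists>k. dist a (c ^ k) < \<eta>" and \<eta>: "\<eta> > 0"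
  obtains N where "\<And>a::complex. norm a = 1 \<Longrightarrow> \<exists>k\<le>N. dist a (c ^ k) < \<eta>"
proof -
  have "sphere 0 1 \<subseteq> (\<Union>k. ball (c ^ k) \<eta>)"
    using dense \<eta> by (fastforce simp: dist_commute)
  then obtain F where F: "finite F" "sphere 0 1 \<subseteq> (\<Union>k\<in>F. ball (c ^ k) \<eta>)"
    using compactE_image[OF compact_sphere[of 0 1], of UNIV "\<lambda>k. ball (c ^ k) \<eta>"] by (metis open_ball)
  show ?thesis
  proof (rule that[of "Max (insert 0 F)"])
    fix a :: complex assume "norm a = 1"
    then have "a \<in> (\<Union>k\<in>F. ball (c ^ k) \<eta>)" by (intro subsetD[OF F(2)]) simp
    then obtain k where "k \<in> F" "dist a (c ^ k) < \<eta>" by (auto simp: dist_commute)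
    then show "\<exists>k\<le>Max (insert 0 F). dist a (c ^ k) < \<eta>" using F(1) by (auto intro!: exI[of _ k] Max_ge)
  qed
qed

section \<open>Iterated symmetrization\<close>

context
  fixes u :: "nat \<Rightarrow> complex"
  assumes u: "\<And>n. n \<ge> 1 \<Longrightarrow> norm (u n) = 1"
begin

lemma u_Suc: "norm (u (Suc n)) = 1" using u by simp

lemma steiner_iter_lmeasurable:
  assumes "M \<in> lmeasurable"
  shows "steiner_iter u n M \<in> lmeasurable" "measure lebesgue (steiner_iter u n M) = measure lebesgue M"
  by (induction n) (use assms steiner_lmeasurable[OF u_Suc] in auto)

lemma d1_steiner_iter_le:
  assumes "A \<in> lmeasurable" "B \<in> lmeasurable"
  shows "d1 (steiner_iter u n A) (steiner_iter u n B) \<le> d1 A B"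
proof (induction n)
  case (Suc n)
  then show ?case
    using d1_steiner_le[OF u_Suc steiner_iter_lmeasurable(1)[OF assms(1)] steiner_iter_lmeasurable(1)[OF assms(2)], of n n n]
    by simp
qed simp

lemma steiner_iter_cball:
  assumes "R \<ge> 0" "M \<subseteq> cball 0 R" shows "steiner_iter u n M \<subseteq> cball 0 R"
proof (induction n)
  case (Suc n)
  have "steiner (u (Suc n)) (steiner_iter u n M) \<subseteq> steiner (u (Suc n)) (cball 0 R)"
    by (rule steiner_mono[OF u_Suc Suc])
  then show ?case using steiner_cball_subset[OF u_Suc assms(1)] by auto
qed (use assms in simp)

text \<open>
  Rules out loss of regularity along the iteration: the neighbourhoods of all
  \<open>steiner_iter u n M\<close> have no larger excess measure than those of
  \<open>M\<close>.
\<close>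

lemma steiner_iter_thicken:
  "(\<Union>x\<in>steiner_iter u n M. ball x e) \<subseteq> steiner_iter u n (\<Union>x\<in>M. ball x e)"
proof (induction n)
  case (Suc n)
  have "(\<Union>x\<in>steiner (u (Suc n)) (steiner_iter u n M). ball x e)
      \<subseteq> steiner (u (Suc n)) (\<Union>x\<in>steiner_iter u n M. ball x e)"
    using steiner_thicken[OF u_Suc] by auto
  also have "\<dots> \<subseteq> steiner (u (Suc n)) (steiner_iter u n (\<Union>x\<in>M. ball x e))"
    by (rule steiner_mono[OF u_Suc Suc])
  finally show ?case by simp
qed simp

text \<open>
  A rotation close to the identity moves the iterate inside its own
  \<open>e\<close>-neighbourhood, and the bound for the excess measure of that neighbourhood
  does not depend on \<open>n\<close>.
\<close>

lemma d1_rotate_steiner_iter: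
  assumes M: "M \<in> lmeasurable" "M \<subseteq> cball 0 R" and R: "R \<ge> 0"
    and N: "(\<Union>x\<in>M. ball x e) \<in> lmeasurable" 
    and a: "norm a = 1" "norm (a - 1) * R < e"
  shows "d1 ((*) a ` steiner_iter u n M) (steiner_iter u n M)
    \<le> 2 * (measure lebesgue (\<Union>x\<in>M. ball x e) - measure lebesgue M)"
proof -
  define K where "K = steiner_iter u n M"
  define U where "U = steiner_iter u n (\<Union>x\<in>M. ball x e)"
  have e: "e > 0" using a(2) R by (metis mult_nonneg_nonneg norm_ge_zero order.strict_trans1)
  have K: "K \<in> lmeasurable" "measure lebesgue K = measure lebesgue M" "K \<subseteq> cball 0 R"
    unfolding K_def by (intro steiner_iter_lmeasurable steiner_iter_cball M R)+
  have U: "U \<in> lmeasurable" "measure lebesgue U = measure lebesgue (\<Union>x\<in>M. ball x e)"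
    unfolding U_def by (intro steiner_iter_lmeasurable N)+
  have aK: "(*) a ` K \<in> lmeasurable" "measure lebesgue ((*) a ` K) = measure lebesgue K"
    by (intro lmeasurable_orthogonal_image orthogonal_rotation a K)+
  have thick: "(\<Union>x\<in>K. ball x e) \<subseteq> U" unfolding K_def U_def by (rule steiner_iter_thicken)
  have KU: "K \<subseteq> U" using thick e by force
  have "(*) a ` K \<subseteq> U"
  proof
    fix z assume "z \<in> (*) a ` K"
    then obtain x where x: "x \<in> K" "z = a * x" by auto
    have "dist x z = norm (a - 1) * norm x"
      using x by (simp add: dist_norm norm_minus_commute norm_mult[symmetric] algebra_simps)
    also have "\<dots> \<le> norm (a - 1) * R" using x K by (intro mult_left_mono) auto
    finally show "z \<in> U" using a x thick by (force simp: subset_iff)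
  qed
  then have "measure lebesgue ((*) a ` K - K) \<le> measure lebesgue (U - K)"
    using aK K U by (intro measure_mono_fmeasurable) auto
  also have "\<dots> = measure lebesgue U - measure lebesgue K"
    using K U KU by (simp add: measurable_measure_Diff fmeasurableD)
  finally show ?thesis
    using d1_equal_measure(2)[OF aK(1) K(1) aK(2)] K U by (simp add: K_def)
qed

text \<open>
  The symmetral of a centred ball lies in the ball and has the same measure, so the ball is
  fixed up to a null set.
\<close>

lemma d1_cball_decreasing:
  assumes M: "M \<in> lmeasurable" and r: "r \<ge> 0"
  shows "decseq (\<lambda>n. d1 (steiner_iter u n M) (cball 0 r))"
proof (rule decseq_SucI)
  fix n
  let ?B = "cball (0::complex) r" and ?K = "steiner_iter u n M" and ?v = "u (Suc n)"
  note K = steiner_iter_lmeasurable(1)[OF M, of n]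
  note st = steiner_lmeasurable[OF u_Suc]
  have "steiner ?v ?B - ?B = {}" using steiner_cball_subset[OF u_Suc r] by auto
  then have "d1 (steiner ?v ?B) ?B = 0"
    using d1_equal_measure(2)[of "steiner ?v ?B" ?B] st[of ?B n]
    by (metis lmeasurable_cball measure_empty mult_zero_right)
  then show "d1 (steiner_iter u (Suc n) M) ?B \<le> d1 ?K ?B"
    using d1_triangle[of "steiner ?v ?K" "steiner ?v ?B" ?B] d1_steiner_le[OF u_Suc K, of ?B n] st K
    by simp
qed

text \<open>
  The energies decrease and are nonnegative, so their differences tend to zero; the energy
  estimate, with \<open>\<eta>\<close> chosen small first, turns this into smallness of the
  differences of the sets.
\<close>

lemma d1_step_tendsto_0:
  assumes M: "M \<in> lmeasurable" "M \<subseteq> cball 0 R" and R: "R \<ge> 0"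
  shows "(\<lambda>n. d1 (steiner_iter u n M) (steiner_iter u (Suc n) M)) \<longlonglongrightarrow> 0"
proof -
  define K where "K n = steiner_iter u n M" for n
  have KS: "K (Suc n) = steiner (u (Suc n)) (K n)" for n by (simp add: K_def)
  have K: "K n \<in> lmeasurable" "K n \<subseteq> cball 0 R" "measure lebesgue (K n) = measure lebesgue M" for n
    unfolding K_def by (intro steiner_iter_lmeasurable steiner_iter_cball M R)+
  have fin: "energy (K n) < \<infinity>" for n
  proof -
    have "energy (K n) \<le> (\<integral>\<^sup>+z. ennreal (R\<^sup>2) * indicator (K n) z \<partial>lebesgue)"
      unfolding energy_def
    proof (rule nn_integral_mono)
      fix z
      show "indicator (K n) z * ennreal ((norm z)\<^sup>2) \<le> ennreal (R\<^sup>2) * indicator (K n) z"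
      proof (cases "z \<in> K n")
        case True
        then have "(norm z)\<^sup>2 \<le> R\<^sup>2" using K(2)[of n] by (intro power_mono) auto
        then show ?thesis using True by (simp add: ennreal_leI)
      qed simp
    qed
    also have "\<dots> = ennreal (R\<^sup>2) * emeasure lebesgue (K n)"
      using K(1)[of n] by (intro nn_integral_cmult_indicator) auto
    also have "\<dots> < \<infinity>" using K(1)[of n] unfolding fmeasurable_def
      by (simp add: ennreal_mult_less_top del: emeasure_completion)
    finally show ?thesis .
  qed
  define E where "E n = enn2real (energy (K n))" for n
  have E: "energy (K n) = ennreal (E n)" for n using fin[of n] by (simp add: E_def)
  have E0: "E n \<ge> 0" for n by (simp add: E_def)
  define m where "m n = measure lebesgue (K n - K (Suc n))" for n
  have step: "E (Suc n) + \<eta>\<^sup>2 * m n \<le> E n + \<eta>\<^sup>2 * (4 * R * \<eta>)" if \<eta>: "\<eta> > 0" for n \<eta>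
  proof -
    have "K n - K (Suc n) \<in> lmeasurable" using K by auto
    then have em: "emeasure lebesgue (K n - K (Suc n)) = ennreal (m n)"
      unfolding m_def by (rule emeasure_eq_measure2)
    have "ennreal (E (Suc n)) + ennreal (\<eta>\<^sup>2) * ennreal (m n) \<le> ennreal (E n) + ennreal (\<eta>\<^sup>2 * (4 * R * \<eta>))"
      using energy_steiner[OF u_Suc fmeasurableD[OF K(1)] K(2) R \<eta>, of n n]
      unfolding KS[symmetric] em E .
    then have "ennreal (E (Suc n) + \<eta>\<^sup>2 * m n) \<le> ennreal (E n + \<eta>\<^sup>2 * (4 * R * \<eta>))"
      using E0 R \<eta> by (simp add: ennreal_mult m_def)
    then show ?thesis using E0[of n] R \<eta> by (subst (asm) ennreal_le_iff) auto
  qed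
  have "E (Suc n) \<le> E n" for n
  proof (rule ccontr)
    assume "\<not> E (Suc n) \<le> E n"
    then have x: "E (Suc n) - E n > 0" by simp
    \<comment> \<open>Small enough that the error term of \<open>step\<close> stays below the
      supposed increase.\<close>
    define \<eta> where "\<eta> = min 1 ((E (Suc n) - E n) / (4 * R + 1))"
    have \<eta>: "\<eta> > 0" "\<eta> \<le> 1" "\<eta> \<le> (E (Suc n) - E n) / (4 * R + 1)" using x R by (auto simp: \<eta>_def)
    have "\<eta>\<^sup>2 * (4 * R * \<eta>) \<le> 1 * (4 * R * \<eta>)"
      using \<eta> R by (intro mult_right_mono) (auto simp: power_le_one)
    also have "\<dots> < (4 * R + 1) * \<eta>" using \<eta> by (simp add: algebra_simps)
    also have "\<dots> \<le> E (Suc n) - E n" using \<eta>(3) R by (simp add: field_simps)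
    finally have "E n + \<eta>\<^sup>2 * (4 * R * \<eta>) < E (Suc n)" by simp
    moreover have "0 \<le> \<eta>\<^sup>2 * m n" by (simp add: m_def)
    ultimately show False using step[OF \<eta>(1), of n] by linarith
  qed
  then have "decseq E" by (intro decseq_SucI)
  then obtain l where "E \<longlonglongrightarrow> l" using decseq_convergent[of E 0] E0 by metis
  then have diff: "(\<lambda>n. E n - E (Suc n)) \<longlonglongrightarrow> 0"
    using tendsto_diff[of E l sequentially "\<lambda>n. E (Suc n)" l] by (simp add: LIMSEQ_Suc)
  have "m \<longlonglongrightarrow> 0"
  proof (rule LIMSEQ_I)
    fix e :: real assume e: "e > 0"
    \<comment> \<open>Makes the boundary layer term \<open>4 R \<eta>\<close> smaller than
      \<open>e / 2\<close>, also if \<open>R = 0\<close>.\<close>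
    define \<eta> where "\<eta> = e / (8 * R + 1)"
    have \<eta>: "\<eta> > 0" "4 * R * \<eta> < e / 2" using e R by (auto simp: \<eta>_def field_simps add_pos_nonneg)
    have "\<eta>\<^sup>2 * (e / 2) > 0" using \<eta> e by simp
    then obtain n0 where n0: "\<And>n. n \<ge> n0 \<Longrightarrow> norm (E n - E (Suc n)) < \<eta>\<^sup>2 * (e / 2)"
      using LIMSEQ_D[OF diff] by (metis diff_zero)
    have "norm (m n - 0) < e" if "n \<ge> n0" for n
    proof -
      have "\<eta>\<^sup>2 * m n \<le> (E n - E (Suc n)) + \<eta>\<^sup>2 * (4 * R * \<eta>)" using step[OF \<eta>(1), of n] by simp
      also have "\<dots> < \<eta>\<^sup>2 * (e / 2) + \<eta>\<^sup>2 * (e / 2)"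
      proof (rule add_less_le_mono)
        show "E n - E (Suc n) < \<eta>\<^sup>2 * (e / 2)"
          using n0[OF that] abs_ge_self[of "E n - E (Suc n)"] unfolding real_norm_def by linarith
      qed (use \<eta> in \<open>auto intro!: mult_left_mono\<close>)
      also have "\<dots> = \<eta>\<^sup>2 * e" by simp
      finally have "m n < e" using \<eta>(1) by simp
      then show ?thesis by (simp add: m_def)
    qed
    then show "\<exists>n0. \<forall>n\<ge>n0. norm (m n - 0) < e" by blast
  qed
  then have "(\<lambda>n. 2 * m n) \<longlonglongrightarrow> 2 * 0" by (intro tendsto_intros)
  moreover have "d1 (K n) (K (Suc n)) = 2 * m n" for n
    unfolding m_def using K by (intro d1_equal_measure) auto
  ultimately show ?thesis by (simp add: K_def)
qed

end

lemma reflect_reflect: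
  fixes v w :: complex
  assumes "norm v = 1"
  shows "(\<lambda>z. - w\<^sup>2 * cnj z) ` (\<lambda>z. - v\<^sup>2 * cnj z) ` K = (*) ((w / v)\<^sup>2) ` K"
proof -
  have "v * cnj v = 1" using assms by (simp add: complex_norm_square[symmetric])
  then have "cnj v = 1 / v" by (metis mult_zero_left nonzero_mult_div_cancel_left zero_neq_one)
  then show ?thesis by (simp add: image_image power_divide)
qed

lemma steiner_reflect_image:
  assumes u: "norm u = 1"
  shows "(\<lambda>z. - u\<^sup>2 * cnj z) ` steiner u M = steiner u M"
proof
  show "steiner u M \<subseteq> (\<lambda>z. - u\<^sup>2 * cnj z) ` steiner u M"
  proof
    fix z assume z: "z \<in> steiner u M"
    have "u * cnj u = 1" using u by (simp add: complex_norm_square[symmetric])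
    then have "(u * cnj u)\<^sup>2 = 1" by simp
    then have "z = - u\<^sup>2 * cnj (- u\<^sup>2 * cnj z)" by (simp add: power_mult_distrib mult.assoc[symmetric])
    then show "z \<in> (\<lambda>z. - u\<^sup>2 * cnj z) ` steiner u M" using steiner_reflect[OF u z] by blast
  qed
qed (use steiner_reflect[OF u] in auto)

text \<open>
  The hypotheses make \<open>K\<close> close to \<open>steiner v K\<close> and also to
  \<open>steiner w K\<close>, which are invariant under the reflections attached to
  \<open>v\<close> and \<open>w\<close>. So \<open>K\<close> is almost invariant under the
  product of these reflections, the rotation by twice the angle from \<open>v\<close> to
  \<open>w\<close>.
\<close>

lemma d1_double_reflection:
  assumes v: "norm v = 1" and w: "norm w = 1" and K: "K \<in> lmeasurable"
    and 1: "d1 K (steiner v K) \<le> \<delta>" and 2: "d1 (steiner v K) (steiner w (steiner v K)) \<le> \<delta>"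
  shows "d1 K ((*) ((w / v)\<^sup>2) ` K) \<le> 8 * \<delta>"
proof -
  define A B where "A = steiner v K" and "B = steiner w K"
  define f g where "f = (\<lambda>z. - v\<^sup>2 * cnj z)" and "g = (\<lambda>z. - w\<^sup>2 * cnj z)"
  have f: "orthogonal_transformation f" and g: "orthogonal_transformation g"
    unfolding f_def g_def by (intro orthogonal_reflection v w)+
  have A: "A \<in> lmeasurable" "f ` A = A" and B: "B \<in> lmeasurable" "g ` B = B"
    unfolding A_def B_def f_def g_def
    by (intro steiner_lmeasurable steiner_reflect_image v w K)+
  have fK: "f ` K \<in> lmeasurable" by (rule lmeasurable_orthogonal_image[OF f K])
  have gA: "g ` A \<in> lmeasurable" by (rule lmeasurable_orthogonal_image[OF g A(1)])
  have gfK: "g ` f ` K \<in> lmeasurable" by (rule lmeasurable_orthogonal_image[OF g fK])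
  have wA: "steiner w A \<in> lmeasurable" by (rule steiner_lmeasurable[OF w A(1)])
  have KA: "d1 K A \<le> \<delta>" using 1 by (simp add: A_def)
  have "d1 (steiner w A) B \<le> d1 A K" unfolding B_def by (rule d1_steiner_le[OF w A(1) K])
  then have KB: "d1 K B \<le> 3 * \<delta>"
    using d1_triangle[OF K A(1) B(1)] d1_triangle[OF A(1) wA B(1)] KA 2
    unfolding A_def[symmetric] by (simp add: d1_commute)
  then have BA: "d1 B A \<le> 4 * \<delta>"
    using d1_triangle[OF B(1) K A(1)] KA by (simp add: d1_commute)
  have "d1 B (g ` A) = d1 B A"
    using d1_orthogonal_image[OF g B(1) A(1)] B(2) by simp
  moreover have "d1 (g ` A) (g ` f ` K) = d1 A K"
    using d1_orthogonal_image[OF g A(1) fK] d1_orthogonal_image[OF f A(1) K] A(2) by simp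
  ultimately have "d1 K (g ` f ` K) \<le> 8 * \<delta>"
    using d1_triangle[OF K B(1) gfK] d1_triangle[OF B(1) gA gfK] KA KB BA by (simp add: d1_commute)
  then show ?thesis unfolding f_def g_def reflect_reflect[OF v] .
qed

lemma d1_rotate_power:
  assumes c: "norm c = 1" and K: "K \<in> lmeasurable"
  shows "d1 K ((*) (c ^ k) ` K) \<le> real k * d1 K ((*) c ` K)"
proof (induction k)
  case 0
  then show ?case by (simp add: d1_def)
next
  case (Suc k)
  have ck: "norm (c ^ k) = 1" using c by (simp add: norm_power)
  have m: "(*) c ` K \<in> lmeasurable" "(*) (c ^ k) ` K \<in> lmeasurable"
    "(*) c ` (*) (c ^ k) ` K \<in> lmeasurable"
    by (intro lmeasurable_orthogonal_image orthogonal_rotation c ck K)+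
  have "(*) (c ^ Suc k) ` K = (*) c ` (*) (c ^ k) ` K" by (simp add: image_image mult.assoc)
  then show ?case
    using d1_triangle[OF K m(1) m(3)] d1_orthogonal_image[OF orthogonal_rotation[OF c] K m(2)] Suc
    by (simp add: algebra_simps)
qed

text \<open>
  Rotating set and direction together changes nothing, so almost rotation invariance transfers
  a bound from the direction \<open>v\<close> to the direction \<open>a * v\<close>.
\<close>

lemma d1_steiner_rotated_direction:
  assumes a: "norm a = 1" and v: "norm v = 1" and K: "K \<in> lmeasurable"
  shows "d1 K (steiner (a * v) K) \<le> 2 * d1 K ((*) a ` K) + d1 K (steiner v K)"
proof -
  have av: "norm (a * v) = 1" using a v by (simp add: norm_mult)
  note rot = orthogonal_rotation[OF a]
  have aK: "(*) a ` K \<in> lmeasurable" by (rule lmeasurable_orthogonal_image[OF rot K])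
  have S: "steiner v K \<in> lmeasurable" "steiner (a * v) K \<in> lmeasurable" "steiner (a * v) ((*) a ` K) \<in> lmeasurable"
    by (intro steiner_lmeasurable v av K aK)+
  have "d1 ((*) a ` K) (steiner (a * v) ((*) a ` K)) = d1 K (steiner v K)"
    unfolding steiner_rotate[OF a v] by (rule d1_orthogonal_image[OF rot K S(1)])
  moreover have "d1 (steiner (a * v) ((*) a ` K)) (steiner (a * v) K) \<le> d1 ((*) a ` K) K"
    by (rule d1_steiner_le[OF av aK K])
  ultimately show ?thesis
    using d1_triangle[OF K aK S(2)] d1_triangle[OF aK S(3) S(2)] by (simp add: d1_commute)
qed

lemma measure_thickening_small:
  fixes M :: "'a::euclidean_space set"
  assumes M: "compact M" and e: "e > 0"
  obtains d where "d > 0" "(\<Union>x\<in>M. ball x d) \<in> lmeasurable"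
    "measure lebesgue (\<Union>x\<in>M. ball x d) \<le> measure lebesgue M + e"
proof -
  have Ml: "M \<in> lmeasurable" using M by (rule lmeasurable_compact)
  obtain V where V: "open V" "M \<subseteq> V" "V - M \<in> lmeasurable" "emeasure lebesgue (V - M) < ennreal e"
    using sets_lebesgue_outer_open[OF fmeasurableD[OF Ml] e] by metis
  obtain d where d: "d > 0" "(\<Union>x\<in>M. ball x d) \<subseteq> V"
    using compact_subset_open_imp_ball_epsilon_subset[OF M V(1,2)] by metis
  have "V = M \<union> (V - M)" using V by auto
  then have Vl: "V \<in> lmeasurable" using fmeasurable.Un[OF Ml V(3)] by simp
  have m: "measure lebesgue (V - M) \<le> e"
    using V(3,4) e emeasure_eq_measure2[OF V(3)] by (simp add: ennreal_less_iff)
  have N: "(\<Union>x\<in>M. ball x d) \<in> lmeasurable"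
    by (rule fmeasurableI2[OF Vl d(2)]) (intro sets_completionI_sets, simp add: open_UN)
  have "measure lebesgue (\<Union>x\<in>M. ball x d) \<le> measure lebesgue V"
    using N Vl d by (intro measure_mono_fmeasurable) auto
  also have "\<dots> = measure lebesgue M + measure lebesgue (V - M)"
    using V Vl Ml by (simp add: measurable_measure_Diff fmeasurableD)
  finally show ?thesis using that[OF d(1) N] m by simp
qed

text \<open>
  Convergence holds for every sequence of directions in which two consecutive directions
  infinitely often enclose the same angle and the rotation \<open>c\<close> by twice that
  angle has dense powers. The order of choices matters: the target accuracy \<open>e1\<close>
  fixes the radius \<open>d\<close> of the thickening, which fixes the number \<open>N\<close>
  of powers of \<open>c\<close> needed, and only then is the step \<open>n\<close> taken so
  late that \<open>N\<close> errors of size \<open>\<delta>\<close> add up to less than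
  \<open>e1\<close>.
\<close>

lemma steiner_iter_compact_tendsto:
  fixes u :: "nat \<Rightarrow> complex"
  assumes u: "\<And>n. n \<ge> 1 \<Longrightarrow> norm (u n) = 1"
    and c: "norm c = 1" and dense: "\<And>a \<eta>. norm a = 1 \<Longrightarrow> \<eta> > 0 \<Longrightarrow> \<exists>k. dist a (c ^ k) < \<eta>"
    and often: "\<And>N. \<exists>n\<ge>N. (u (Suc (Suc n)) / u (Suc n))\<^sup>2 = c"
    and M: "compact M" and r: "r \<ge> 0" and eq: "measure lebesgue M = measure lebesgue (cball (0::complex) r)"
  shows "(\<lambda>n. d1 (steiner_iter u n M) (cball 0 r)) \<longlonglongrightarrow> 0"
proof -
  have Ml: "M \<in> lmeasurable" using M by (rule lmeasurable_compact)
  obtain R0 where R0: "\<And>x. x \<in> M \<Longrightarrow> norm x \<le> R0" using compact_imp_bounded[OF M] bounded_iff by metis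
  define R where "R = max r R0"
  have R: "R \<ge> 0" "r \<le> R" "M \<subseteq> cball 0 R" using R0 r by (auto simp: R_def le_max_iff_disj)
  define K where "K n = steiner_iter u n M" for n
  have K: "K n \<in> lmeasurable" "K n \<subseteq> cball 0 R" "measure lebesgue (K n) = measure lebesgue (cball (0::complex) r)" for n
    unfolding K_def eq[symmetric]
    by (intro steiner_iter_lmeasurable[where u=u, OF u] steiner_iter_cball[where u=u, OF u] Ml R; assumption)+
  have KS: "K (Suc n) = steiner (u (Suc n)) (K n)" for n by (simp add: K_def)
  have uS: "norm (u (Suc n)) = 1" for n using u by simp
  let ?B = "cball (0::complex) r"
  have close: "\<exists>n. d1 (K n) ?B < e" if e: "e > 0" for e
  proof -
    define C where "C = measure lebesgue (cball (0::complex) (2 * R))"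
    \<comment> \<open>The accuracy that \<open>ball_deficit_le\<close> needs.\<close>
    define e1 where "e1 = (e / 2)\<^sup>2 / (C + 1)"
    have C: "C \<ge> 0" by (simp add: C_def)
    have e1: "e1 > 0" using e C by (simp add: e1_def add_nonneg_pos)
    have "e1 * C < e1 * (C + 1)" using e1 by simp
    also have "\<dots> = (e / 2)\<^sup>2" using C by (simp add: e1_def)
    finally have e1C: "e1 * C < (e / 2)\<^sup>2" .
    obtain d where d: "d > 0" "(\<Union>x\<in>M. ball x d) \<in> lmeasurable"
      "measure lebesgue (\<Union>x\<in>M. ball x d) \<le> measure lebesgue M + e1 / 16"
      using measure_thickening_small[OF M, of "e1 / 16"] e1 by auto
    have "d / (R + 1) > 0" using d R by simp
    then obtain N where N: "\<And>a. norm a = 1 \<Longrightarrow> \<exists>k\<le>N. dist a (c ^ k) < d / (R + 1)"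
      using powers_uniformly_dense[OF dense] by metis
    \<comment> \<open>The final estimate costs \<open>(16 N + 1) \<delta>\<close>: at most
      \<open>N\<close> rotations by \<open>c\<close>, each costing \<open>8 \<delta>\<close>,
      doubled by the change of direction.\<close>
    define \<delta> where "\<delta> = e1 / (2 * (16 * real N + 1))"
    have \<delta>: "\<delta> > 0" using e1 by (simp add: \<delta>_def add_nonneg_pos)
    have \<delta>': "(16 * real N + 1) * \<delta> = e1 / 2"
    proof -
      have half: "x * (e1 / (2 * x)) = e1 / 2" if "x > 0" for x :: real using that by simp
      show ?thesis unfolding \<delta>_def by (rule half) (simp add: add_nonneg_pos)
    qed
    obtain n0 where n0: "\<And>n. n \<ge> n0 \<Longrightarrow> norm (d1 (K n) (K (Suc n)) - 0) < \<delta>"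
      using LIMSEQ_D[OF d1_step_tendsto_0[where u=u, OF u Ml R(3,1)] \<delta>] unfolding K_def by metis
    obtain n where n: "n \<ge> n0" "(u (Suc (Suc n)) / u (Suc n))\<^sup>2 = c" using often by blast
    have st: "d1 (K n) (K (Suc n)) \<le> \<delta>" "d1 (K (Suc n)) (K (Suc (Suc n))) \<le> \<delta>"
      using n0[of n] n0[of "Suc n"] n(1) by (auto simp: d1_nonneg)
    define v where "v = u (Suc n)"
    have v: "norm v = 1" using uS by (simp add: v_def)
    have rot: "d1 (K n) ((*) c ` K n) \<le> 8 * \<delta>"
      using d1_double_reflection[OF uS uS K(1), of n n \<delta> "Suc n"] st n(2) by (simp add: KS)
    have all_rot: "d1 (K n) ((*) a ` K n) \<le> 8 * real N * \<delta> + e1 / 8" if a: "norm a = 1" for a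
    proof -
      obtain k where k: "k \<le> N" "dist a (c ^ k) < d / (R + 1)" using N[OF a] by blast
      have ck: "norm (c ^ k) = 1" using c by (simp add: norm_power)
      have ck0: "c ^ k \<noteq> 0" using ck by (metis norm_zero zero_neq_one)
      \<comment> \<open>The rest \<open>b\<close> is a rotation close to the identity.\<close>
      define b where "b = a / c ^ k"
      have b: "norm b = 1" "a = c ^ k * b" using a ck ck0 by (auto simp: b_def norm_divide)
      have "norm (b - 1) = norm (c ^ k) * norm (b - 1)" using ck by simp
      also have "\<dots> = dist a (c ^ k)" unfolding b(2) dist_norm norm_mult[symmetric] by (simp add: algebra_simps)
      finally have "norm (b - 1) < d / (R + 1)" using k by simp
      then have "norm (b - 1) * R \<le> d / (R + 1) * R" using R by (intro mult_right_mono) auto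
      also have "\<dots> < d" using d R by (simp add: field_simps)
      finally have bR: "norm (b - 1) * R < d" .
      have bK: "d1 ((*) b ` K n) (K n) \<le> e1 / 8"
        using d1_rotate_steiner_iter[where u=u, OF u Ml R(3,1) d(2) b(1) bR, of n] d(3) by (simp add: K_def)
      have m: "(*) b ` K n \<in> lmeasurable" "(*) (c ^ k) ` K n \<in> lmeasurable" "(*) (c ^ k) ` (*) b ` K n \<in> lmeasurable"
        by (intro lmeasurable_orthogonal_image orthogonal_rotation ck b K)+
      have "(*) a ` K n = (*) (c ^ k) ` (*) b ` K n" by (simp add: b(2) image_image mult.assoc)
      moreover have "d1 (K n) ((*) (c ^ k) ` K n) \<le> 8 * real N * \<delta>"
      proof -
        have "d1 (K n) ((*) (c ^ k) ` K n) \<le> real k * d1 (K n) ((*) c ` K n)"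
          by (rule d1_rotate_power[OF c K(1)])
        also have "\<dots> \<le> real N * (8 * \<delta>)" using rot k(1) by (intro mult_mono) (auto simp: d1_nonneg)
        finally show ?thesis by simp
      qed
      moreover have "d1 ((*) (c ^ k) ` K n) ((*) (c ^ k) ` (*) b ` K n) = d1 (K n) ((*) b ` K n)"
        by (rule d1_orthogonal_image[OF orthogonal_rotation[OF ck] K(1) m(1)])
      ultimately show ?thesis
        using d1_triangle[OF K(1)[of n] m(2,3)] bK by (simp add: d1_commute)
    qed
    have all_dir: "d1 (K n) (steiner w (K n)) \<le> e1" if w: "norm w = 1" for w
    proof -
      define a where "a = w / v"
      have "v \<noteq> 0" using v by auto
      then have a: "norm a = 1" "w = a * v" using v w by (auto simp: a_def norm_divide)
      have "d1 (K n) (steiner w (K n)) \<le> 2 * (8 * real N * \<delta> + e1 / 8) + \<delta>"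
        using d1_steiner_rotated_direction[OF a(1) v K(1), of n] all_rot[OF a(1)] st(1)
        unfolding a(2) by (simp add: KS v_def)
      also have "\<dots> = (16 * real N + 1) * \<delta> + e1 / 4" by (simp add: algebra_simps)
      also have "\<dots> \<le> e1" using \<delta>' e1 by simp
      finally show ?thesis .
    qed
    have "(measure lebesgue (K n - ?B))\<^sup>2 \<le> e1 * C"
      unfolding C_def by (rule ball_deficit_le[OF K(1,2) R(2) K(3) all_dir])
    also have "\<dots> < (e / 2)\<^sup>2" by (rule e1C)
    finally have "measure lebesgue (K n - ?B) < e / 2" by (rule power_less_imp_less_base) (use e in simp)
    then have "d1 (K n) ?B < e" using d1_equal_measure(2)[OF K(1) lmeasurable_cball K(3)] by simp
    then show ?thesis by blast
  qed
  show ?thesis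
  proof (rule LIMSEQ_I)
    fix e :: real assume "e > 0"
    then obtain n0 where n0: "d1 (K n0) ?B < e" using close by blast
    have "d1 (K n) ?B < e" if "n \<ge> n0" for n
      using decseqD[OF d1_cball_decreasing[where u=u, OF u Ml r] that] n0 unfolding K_def by simp
    then show "\<exists>n0. \<forall>n\<ge>n0. norm (d1 (steiner_iter u n M) ?B - 0) < e"
      by (auto simp: K_def d1_nonneg intro!: exI[of _ n0])
  qed
qed

lemma lmeasurable_inner_compact:
  fixes M :: "'a::euclidean_space set"
  assumes M: "M \<in> lmeasurable" and e: "e > 0"
  obtains K where "compact K" "K \<subseteq> M" "measure lebesgue (M - K) < e"
proof -
  obtain F where F: "closed F" "F \<subseteq> M" "M - F \<in> lmeasurable" "emeasure lebesgue (M - F) < ennreal (e / 2)"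
    using sets_lebesgue_inner_closed[OF fmeasurableD[OF M], of "e / 2"] e by auto
  define K where "K n = F \<inter> cball 0 (real n)" for n
  have Fl: "F \<in> lmeasurable" by (rule fmeasurableI2[OF M F(2)]) (use F(1) in \<open>auto intro!: sets_completionI_sets\<close>)
  have Kc: "compact (K n)" for n unfolding K_def using F(1) by (intro closed_Int_compact compact_cball)
  have "(\<lambda>n. measure lebesgue (K n)) \<longlonglongrightarrow> measure lebesgue (\<Union>n. K n)"
  proof (rule Lim_measure_incseq)
    show "range K \<subseteq> sets lebesgue" using Kc lmeasurable_compact by blast
    show "incseq K" by (auto simp: K_def incseq_def)
    have "(\<Union>n. K n) \<subseteq> F" by (auto simp: K_def)
    moreover have "(\<Union>n. K n) \<in> sets lebesgue" using Kc lmeasurable_compact by blast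
    ultimately have "(\<Union>n. K n) \<in> lmeasurable" using Fl fmeasurableI2 by metis
    then show "emeasure lebesgue (\<Union>n. K n) \<noteq> \<infinity>" by (auto simp: fmeasurable_def)
  qed
  moreover have "(\<Union>n. K n) = F" by (auto simp: K_def real_arch_simple)
  ultimately have "(\<lambda>n. measure lebesgue (K n)) \<longlonglongrightarrow> measure lebesgue F" by simp
  then obtain n where "norm (measure lebesgue (K n) - measure lebesgue F) < e / 2"
    using LIMSEQ_D[of _ _ "e / 2"] e by (meson half_gt_zero order_refl)
  moreover have "measure lebesgue (M - F) < e / 2"
    using F(4) e emeasure_eq_measure2[OF F(3)] by (simp add: ennreal_less_iff)
  moreover have "measure lebesgue (M - F) = measure lebesgue M - measure lebesgue F"
    "measure lebesgue (M - K n) = measure lebesgue M - measure lebesgue (K n)"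
    using M Fl Kc[of n] F(2) lmeasurable_compact[OF Kc]
    by (auto intro!: measurable_measure_Diff simp: K_def)
  ultimately have "measure lebesgue (M - K n) < e" unfolding real_norm_def by linarith
  then show ?thesis using that[OF Kc[of n]] F(2) by (auto simp: K_def)
qed

lemma measure_cball_complex: "r \<ge> 0 \<Longrightarrow> measure lebesgue (cball (0::complex) r) = pi * r\<^sup>2"
  by (simp add: content_cball unit_ball_vol_2)

text \<open>
  A compact subset \<open>K\<close> of almost full measure has iterates close to those of
  \<open>M\<close>, and its ball is close to the ball of \<open>M\<close> because concentric
  balls are nested.
\<close>

lemma steiner_iter_tendsto:
  fixes u :: "nat \<Rightarrow> complex"
  assumes u: "\<And>n. n \<ge> 1 \<Longrightarrow> norm (u n) = 1"
    and c: "norm c = 1" and dense: "\<And>a \<eta>. norm a = 1 \<Longrightarrow> \<eta> > 0 \<Longrightarrow> \<exists>k. dist a (c ^ k) < \<eta>"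
    and often: "\<And>N. \<exists>n\<ge>N. (u (Suc (Suc n)) / u (Suc n))\<^sup>2 = c"
    and M: "M \<in> lmeasurable" and r: "r \<ge> 0" and eq: "measure lebesgue M = measure lebesgue (cball (0::complex) r)"
  shows "(\<lambda>n. d1 (steiner_iter u n M) (cball 0 r)) \<longlonglongrightarrow> 0"
proof (rule LIMSEQ_I)
  fix e :: real assume e: "e > 0"
  obtain K where K: "compact K" "K \<subseteq> M" "measure lebesgue (M - K) < e / 3"
    using lmeasurable_inner_compact[OF M, of "e / 3"] e by auto
  have Kl: "K \<in> lmeasurable" using K(1) by (rule lmeasurable_compact)
  have diff: "measure lebesgue (M - K) = measure lebesgue M - measure lebesgue K"
    using M Kl K(2) by (intro measurable_measure_Diff) auto
  define s where "s = sqrt (measure lebesgue K / pi)"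
  have s: "s \<ge> 0" "measure lebesgue K = measure lebesgue (cball (0::complex) s)"
  proof -
    show "s \<ge> 0" by (simp add: s_def)
    then have "measure lebesgue (cball (0::complex) s) = pi * s\<^sup>2" by (rule measure_cball_complex)
    then show "measure lebesgue K = measure lebesgue (cball (0::complex) s)" by (simp add: s_def)
  qed
  have "pi * s\<^sup>2 \<le> pi * r\<^sup>2"
    using diff s(2) eq measure_nonneg[of lebesgue "M - K"]
      measure_cball_complex[OF s(1)] measure_cball_complex[OF r] by linarith
  then have "s\<^sup>2 \<le> r\<^sup>2" by simp
  then have sr: "s \<le> r" using r by (rule power2_le_imp_le)
  let ?Br = "cball (0::complex) r" and ?Bs = "cball (0::complex) s"
  have "d1 ?Bs ?Br = measure lebesgue (?Br - ?Bs)" using sr by (simp add: d1_def Diff_eq_empty_iff[THEN iffD2] subset_cball)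
  also have "\<dots> = measure lebesgue ?Br - measure lebesgue ?Bs"
    by (rule measurable_measure_Diff) (use sr in \<open>auto intro: subset_cball[THEN subsetD]\<close>)
  finally have dB: "d1 ?Bs ?Br < e / 3" using diff s eq K(3) by simp
  have "d1 M K = measure lebesgue (M - K)" using K(2) by (simp add: d1_def Diff_eq_empty_iff[THEN iffD2])
  then have dMK: "d1 (steiner_iter u n M) (steiner_iter u n K) < e / 3" for n
    using d1_steiner_iter_le[where u=u, OF u M Kl, of n] K(3) by simp
  obtain n0 where n0: "\<And>n. n \<ge> n0 \<Longrightarrow> norm (d1 (steiner_iter u n K) ?Bs - 0) < e / 3"
    using LIMSEQ_D[OF steiner_iter_compact_tendsto[where u=u, OF u c dense often K(1) s], of "e / 3"] e by auto
  have "d1 (steiner_iter u n M) ?Br < e" if "n \<ge> n0" for n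
  proof -
    have m: "steiner_iter u n M \<in> lmeasurable" "steiner_iter u n K \<in> lmeasurable"
      by (intro steiner_iter_lmeasurable[where u=u, OF u] M Kl; assumption)+
    show ?thesis
      using d1_triangle[OF m lmeasurable_cball[of 0 r]] d1_triangle[OF m(2) lmeasurable_cball[of 0 s] lmeasurable_cball[of 0 r]]
        dMK[of n] dB n0[OF that] by (simp add: d1_nonneg)
  qed
  then show "\<exists>n0. \<forall>n\<ge>n0. norm (d1 (steiner_iter u n M) ?Br - 0) < e"
    by (auto simp: d1_nonneg)
qed

theorem theorem4p2:
  fixes M Mstar :: "complex set" and r :: real and u :: "nat \<Rightarrow> complex"
    and T :: "nat \<Rightarrow> complex set"
  assumes M: "M \<in> lmeasurable"
    and r: "r \<ge> 0"
    and Mstar: "Mstar = cball 0 r" "measure lebesgue Mstar = measure lebesgue M"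
    and u: "\<And>n. n \<ge> 1 \<Longrightarrow> u n = cis (pi * kakutani_fibonacci n)"
    and T: "\<And>n. T n = steiner_iter u n M"
  shows "(\<forall>n. T n \<in> lmeasurable) \<and> (\<lambda>n. d1 (T n) Mstar) \<longlonglongrightarrow> 0"
proof
  have unit: "norm (u n) = 1" if "n \<ge> 1" for n using u[OF that] by simp
  show "\<forall>n. T n \<in> lmeasurable"
    unfolding T by (intro allI steiner_iter_lmeasurable(1)[where u=u] unit M)
  have "(\<lambda>n. d1 (steiner_iter u n M) (cball 0 r)) \<longlonglongrightarrow> 0"
  proof (rule steiner_iter_tendsto[where u=u, OF unit _ irrational_rotation_dense[OF kf_gamma_irrational] _ M r])
    show "\<exists>n\<ge>N. (u (Suc (Suc n)) / u (Suc n))\<^sup>2 = cis (2 * pi * kf_gamma)" for N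
    proof -
      obtain n where n: "n \<ge> N" "kakutani_fibonacci (Suc (Suc n)) = kakutani_fibonacci (Suc n) + kf_gamma"
        using kakutani_fibonacci_step by blast
      have "u (Suc (Suc n)) / u (Suc n) = cis (pi * kf_gamma)"
        by (simp add: u n(2) cis_divide algebra_simps)
      then have "(u (Suc (Suc n)) / u (Suc n))\<^sup>2 = cis (2 * pi * kf_gamma)"
        by (simp add: Complex.DeMoivre algebra_simps)
      then show ?thesis using n(1) by blast
    qed
  qed (use Mstar in simp_all)
  then show "(\<lambda>n. d1 (T n) Mstar) \<longlonglongrightarrow> 0" unfolding T Mstar(1) .
qed

end
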